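(* Let $z\in\mathbb{C}$ with $\Re z>0$ and let $s\in\mathbb{C}$ be not a positive integer. Then $$\lim_{q\to1-0}\Big\{\zeta(s,z:q)+\frac{(q-q^2)^s q^{-zs}}{\log q}\,\frac{\pi}{\sin\pi s}\Big\}=\zeta(s,z),$$ where $\zeta(s,z)$ is the Hurwitz zeta-function.
   Context: For $0<q<1$, $[x]_q=\frac{1-q^x}{1-q}$, and $\zeta(s,z:q)$ denotes the meromorphic continuation to the whole $s$-plane of $\sum_{k=0}^{\infty}q^{s(k+1)}/[k+z]_q^{\,s}$ (convergent for $\Re s>0$), with complex powers via the principal branch. The Hurwitz zeta-function $\zeta(s,z)$ is the meromorphic continuation of $\sum_{k=0}^\infty (k+z)^{-s}$ ($\Re s>1$). *)

theory Defs
  imports "HOL-Complex_Analysis.Complex_Analysis"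
begin

text \<open>Meromorphic continuation to the whole plane of a function f given on a region A:
  any F meromorphic on the whole plane agreeing with f on A; normalised by remove_sings
  (value = limit where the limit exists, so the result is independent of the choice of F
  and of its junk values at isolated points; value 0 at poles).\<close>
definition mero_cont :: "(complex \<Rightarrow> complex) \<Rightarrow> complex set \<Rightarrow> complex \<Rightarrow> complex" where
  "mero_cont f A = remove_sings (SOME F. F meromorphic_on UNIV \<and> (\<forall>s\<in>A. F s = f s))"

definition qnum :: "real \<Rightarrow> complex \<Rightarrow> complex" where
  "qnum q x = (1 - complex_of_real q powr x) / (1 - complex_of_real q)"

definition q_hurwitz_zeta :: "complex \<Rightarrow> complex \<Rightarrow> real \<Rightarrow> complex" where
  "q_hurwitz_zeta s z q = mero_cont
     (\<lambda>w. \<Sum>k. complex_of_real q powr (w * (of_nat k + 1)) / (qnum q (of_nat k + z)) powr w)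
     {w. Re w > 0} s"

definition hurwitz_zeta :: "complex \<Rightarrow> complex \<Rightarrow> complex" where
  "hurwitz_zeta s z = mero_cont (\<lambda>w. \<Sum>k. (of_nat k + z) powr (- w)) {w. Re w > 1} s"

end

theory Submission
  imports Defs
begin

text \<open>
  Put \<open>\<epsilon> = - ln q\<close>.  Up to an elementary factor, the \<open>k\<close>-th term of the \<open>q\<close>-series is
  \<open>g\<^sub>s(\<epsilon>(k + z))\<close> with \<open>g\<^sub>s(x) = (e\<^sup>x - 1)\<^sup>-\<^sup>s\<close>.  Expanding binomially and summing over \<open>k\<close>
  continues the series to \<open>\<Sum>r. c\<^sub>r(s) e\<^bsup>-az\<^esup> / (1 - e\<^bsup>-a\<^esup>)\<close>, where \<open>a = \<epsilon>(s + r)\<close> and \<open>c\<^sub>r(s)\<close> is the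
  rising factorial \<open>s(s+1)...(s+r-1)\<close> divided by \<open>r!\<close>.  The Beta integral
  \<open>\<integral>\<^sub>0\<^sup>1 (p/(1-p))\<^sup>c dp = \<pi>c / sin \<pi>c\<close> writes each \<open>e\<^bsup>-az\<^esup> / (1 - e\<^bsup>-a\<^esup>)\<close> as \<open>e\<^bsup>-az\<^esup>\<close> plus an average of
  \<open>e\<^bsup>-ax\<^esup>/a\<close> over the vertical line through \<open>z + 1/2\<close>, which is Jensen's formula
  for the Hurwitz zeta function applied to exponentials.  Hence the \<open>q\<close>-zeta function is its first term plus an average of the primitive \<open>P\<^sub>s\<close> of \<open>-g\<^sub>s\<close> that
  vanishes at infinity (an incomplete Beta function).  Near 0 the regular part of \<open>P\<^sub>s\<close> is
  \<open>\<pi> / sin \<pi>s\<close>, so the correction term of the theorem turns \<open>P\<^sub>s\<close> into the primitive normalised at 0.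
  After rescaling, the resulting integral is jointly continuous in \<open>(\<epsilon>, s)\<close> down to \<open>\<epsilon> = 0\<close>, also
  at the nonpositive integers \<open>s\<close>.  Its value at \<open>\<epsilon> = 0\<close> is Jensen's integral, and it agrees with
  the Hurwitz series for \<open>1 < Re s < 2\<close> because there the limit can also be taken termwise.
  For \<open>Re s \<ge> 2\<close> the theorem is this termwise limit.
\<close>

section \<open>Binomial series and incomplete Beta functions\<close>

text \<open>Polymorphic in the field, because the real instance serves as a majorant of the complex
  one.\<close>

definition neg_binom :: "'a::field_char_0 \<Rightarrow> nat \<Rightarrow> 'a" where
  "neg_binom w r = pochhammer w r / fact r"

lemma neg_binom_gchoose: "neg_binom w r * u ^ r = ((-w) gchoose r) * (-u) ^ r"
  by (simp add: neg_binom_def gbinomial_pochhammer power_minus[of u] mult_ac)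

lemma neg_binom_sums:
  fixes u w :: complex
  assumes "norm u < 1"
  shows "(\<lambda>r. neg_binom w r * u ^ r) sums (1 - u) powr (-w)"
  using gen_binomial_complex[of "-u" "-w"] assms by (simp add: neg_binom_gchoose)

lemma summable_neg_binom_real:
  fixes R x :: real
  assumes "\<bar>x\<bar> < 1"
  shows "summable (\<lambda>r. neg_binom R r * x ^ r)"
  using gen_binomial_real[of "-x" "-R"] assms by (simp add: neg_binom_gchoose sums_iff)

lemma pochhammer_nonneg_real: "R \<ge> 0 \<Longrightarrow> pochhammer (R::real) r \<ge> 0"
  by (induction r) (auto simp: pochhammer_Suc)

lemma neg_binom_nonneg: "R \<ge> 0 \<Longrightarrow> neg_binom (R::real) r \<ge> 0"
  by (simp add: neg_binom_def pochhammer_nonneg_real)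

lemma norm_neg_binom_le:
  fixes w :: complex
  assumes "norm w \<le> R"
  shows "norm (neg_binom w r) \<le> neg_binom R r"
proof -
  have R: "R \<ge> 0" using assms norm_ge_zero order_trans by blast
  have "norm (pochhammer w r) \<le> pochhammer R r"
  proof (induction r)
    case (Suc r)
    have "norm (w + of_nat r) \<le> R + of_nat r"
      using norm_triangle_ineq[of w "of_nat r"] assms by simp
    thus ?case
      unfolding pochhammer_Suc norm_mult
      by (intro mult_mono Suc) (use R in \<open>auto simp: pochhammer_nonneg_real\<close>)
  qed auto
  thus ?thesis by (simp add: neg_binom_def norm_divide divide_right_mono)
qed

text \<open>\<open>u\<^sup>w ibeta w u\<close> is the incomplete Beta integral of \<open>t\<^bsup>w-1\<^esup> (1 - t)\<^bsup>-w\<^esup>\<close> over \<open>[0, u]\<close>.\<close>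

definition ibeta :: "complex \<Rightarrow> complex \<Rightarrow> complex" where
  "ibeta w u = (\<Sum>r. neg_binom w r / (w + of_nat r) * u ^ r)"

text \<open>From index \<open>norm w + 1\<close> on the denominators have norm at least 1, and a
  real binomial series in \<open>norm u\<close> is a majorant. Only finitely many terms precede; one
  with denominator 0 has the value 0.\<close>

lemma summable_norm_ibeta:
  fixes u w :: complex
  assumes "norm u < 1"
  shows "summable (\<lambda>r. norm (neg_binom w r / (w + of_nat r) * u ^ r))"
proof (rule summable_comparison_test')
  show "summable (\<lambda>r. neg_binom (norm w) r * norm u ^ r)"
    using summable_neg_binom_real[of "norm u"] assms by simp
  fix r assume r: "r \<ge> nat \<lceil>norm w + 1\<rceil>"
  have "real r \<ge> norm w + 1" using r by linarith
  hence "norm (w + of_nat r) \<ge> 1"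
    using norm_triangle_ineq4[of "w + of_nat r" w] by simp
  hence "norm (neg_binom w r) / norm (w + of_nat r) \<le> neg_binom (norm w) r / 1"
    by (intro frac_le norm_neg_binom_le) (auto simp: neg_binom_nonneg)
  from mult_right_mono[OF this, of "norm u ^ r"]
  show "norm (norm (neg_binom w r / (w + of_nat r) * u ^ r)) \<le> neg_binom (norm w) r * norm u ^ r"
    by (simp add: norm_mult norm_divide norm_power)
qed

lemma summable_ibeta:
  fixes u w :: complex
  shows "norm u < 1 \<Longrightarrow> summable (\<lambda>r. neg_binom w r / (w + of_nat r) * u ^ r)"
  by (rule summable_norm_cancel[OF summable_norm_ibeta])

text \<open>Multiplying the n-th coefficient by \<open>w + n\<close> cancels its denominator and
  leaves the binomial series. The derivative is described by an equation rather than solved for, so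
  that u = 0 is not exceptional.\<close>

lemma ibeta_has_field_derivative:
  fixes u w :: complex
  assumes u: "norm u < 1" and w: "\<And>r. w \<noteq> - of_nat r"
  obtains d where "(ibeta w has_field_derivative d) (at u)" "u * d + w * ibeta w u = (1 - u) powr (-w)"
proof
  define c where "c = (\<lambda>r. neg_binom w r / (w + of_nat r))"
  have ib: "ibeta w = (\<lambda>u. \<Sum>r. c r * u ^ r)" by (simp add: ibeta_def c_def fun_eq_iff)
  have sm: "summable (\<lambda>r. c r * v ^ r)" if "norm v < 1" for v
    using summable_ibeta[OF that] by (simp add: c_def)
  show "(ibeta w has_field_derivative (\<Sum>n. diffs c n * u ^ n)) (at u)"
    unfolding ib by (rule termdiffs_strong'[OF sm u])
  have "summable (\<lambda>n. diffs c n * u ^ n)"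
    using termdiff_converges[OF u sm] by simp
  from diffs_equiv[OF this]
  have "(\<lambda>n. u * (of_nat n * c n * u ^ (n - Suc 0)) + w * (c n * u ^ n)) sums
        (u * (\<Sum>n. diffs c n * u ^ n) + w * (\<Sum>n. c n * u ^ n))"
    by (intro sums_add sums_mult summable_sums sm u)
  also have "(\<lambda>n. u * (of_nat n * c n * u ^ (n - Suc 0)) + w * (c n * u ^ n)) = (\<lambda>n. neg_binom w n * u ^ n)"
  proof
    fix n
    have nz: "w + of_nat n \<noteq> 0" using w[of n] by (metis add_eq_0_iff2)
    have "u * (of_nat n * c n * u ^ (n - Suc 0)) = of_nat n * c n * u ^ n"
      by (cases n) (auto simp: mult_ac)
    hence "u * (of_nat n * c n * u ^ (n - Suc 0)) + w * (c n * u ^ n) = c n * (w + of_nat n) * u ^ n"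
      by (simp add: algebra_simps)
    thus "u * (of_nat n * c n * u ^ (n - Suc 0)) + w * (c n * u ^ n) = neg_binom w n * u ^ n"
      using nz by (simp add: c_def)
  qed
  finally show "u * (\<Sum>n. diffs c n * u ^ n) + w * ibeta w u = (1 - u) powr (-w)"
    using neg_binom_sums[OF u, of w] unfolding ib by (rule sums_unique2)
qed

text \<open>For Re w > 0 and real u in (0, 1), u^w times the left-hand side is the integral of w
  t^(w-1) (1-t)^(-w-1) over [0, u], which is (u / (1-u))^w. In general the two contributions to the
  coefficient of u^(r+1) add up to the numerator w + r + 1, which cancels the denominator.\<close>

lemma ibeta_recurrence:
  fixes u w :: complex
  assumes u: "norm u < 1" and w: "\<And>r. w \<noteq> - of_nat r"
  shows "w * (ibeta w u + u * ibeta (w + 1) u) = (1 - u) powr (-w)"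
proof -
  have w0: "w \<noteq> 0" using w[of 0] by simp
  have "(\<lambda>r. w * (neg_binom w (Suc r) / (w + of_nat (Suc r)) * u ^ Suc r +
            u * (neg_binom (w+1) r / (w + 1 + of_nat r) * u ^ r)))
        sums (w * ((ibeta w u - neg_binom w 0 / (w + of_nat 0) * u ^ 0) + u * ibeta (w+1) u))"
    using summable_ibeta[OF u, of w] summable_ibeta[OF u, of "w+1"]
    unfolding ibeta_def
    by (intro sums_mult sums_add summable_sums)
       (subst sums_Suc_iff, auto)
  also have "(\<lambda>r. w * (neg_binom w (Suc r) / (w + of_nat (Suc r)) * u ^ Suc r +
            u * (neg_binom (w+1) r / (w + 1 + of_nat r) * u ^ r))) = (\<lambda>r. neg_binom w (Suc r) * u ^ Suc r)"
  proof
    fix r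
    have nz: "w + 1 + of_nat r \<noteq> 0" using w[of "Suc r"]
      by (metis add.assoc add.commute add_eq_0_iff2 of_nat_Suc)
    have eq: "neg_binom (w+1) r = neg_binom w (Suc r) * (of_nat r + 1) / w"
    proof -
      have "(1 + of_nat r :: complex) \<noteq> 0" by (metis of_nat_Suc of_nat_neq_0)
      thus ?thesis using w0 by (simp add: neg_binom_def pochhammer_rec divide_simps)
    qed
    define N d where "N = neg_binom w (Suc r)" and "d = w + 1 + of_nat r"
    have "w * (N / d * u ^ Suc r + u * (N * (of_nat r + 1) / w / d * u ^ r)) = N * u ^ Suc r * (w + (of_nat r + 1)) / d"
      using w0 nz unfolding d_def[symmetric] by (simp add: field_simps)
    also have "w + (of_nat r + 1) = d" by (simp add: d_def)
    finally show "w * (neg_binom w (Suc r) / (w + of_nat (Suc r)) * u ^ Suc r +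
            u * (neg_binom (w+1) r / (w + 1 + of_nat r) * u ^ r)) = neg_binom w (Suc r) * u ^ Suc r"
      using nz eq unfolding d_def[symmetric] N_def[symmetric] by (simp add: d_def add_ac)
  qed
  finally have "(\<lambda>r. neg_binom w (Suc r) * u ^ Suc r) sums
     (w * ((ibeta w u - neg_binom w 0 / (w + of_nat 0) * u ^ 0) + u * ibeta (w+1) u))" .
  moreover have "(\<lambda>r. neg_binom w (Suc r) * u ^ Suc r) sums ((1 - u) powr (-w) - neg_binom w 0 * u ^ 0)"
    using neg_binom_sums[OF u, of w] by (subst sums_Suc_iff) auto
  ultimately have "w * ((ibeta w u - neg_binom w 0 / (w + of_nat 0) * u ^ 0) + u * ibeta (w+1) u)
     = (1 - u) powr (-w) - neg_binom w 0 * u ^ 0" by (rule sums_unique2)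
  thus ?thesis using w0 by (simp add: neg_binom_def algebra_simps)
qed

section \<open>Integrals over the unit interval\<close>

text \<open>The endpoints are left out so that continuity on the open interval, where
  \<open>logit\<close> is continuous, yields measurability.\<close>

abbreviation unit_lborel :: "real measure" where
  "unit_lborel \<equiv> restrict_space lborel {0<..<1}"

lemma borel_measurable_unit_lborel:
  fixes f :: "real \<Rightarrow> 'a::topological_space"
  assumes "continuous_on {0<..<1} f"
  shows "f \<in> borel_measurable unit_lborel"
  using borel_measurable_continuous_on_restrict[OF assms]
  by (subst measurable_cong_sets[OF sets_restrict_space_cong refl, of _ borel]) auto

text \<open>Dominated convergence along sequences. The parameter space is a general metric space
  because it will consist of pairs (\<open>\<epsilon>\<close>, s), and once of such pairs together
  with a point p of the interval.\<close>

lemma continuous_on_integral_dominated: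
  fixes f :: "'u::metric_space \<Rightarrow> real \<Rightarrow> complex"
  assumes cont: "continuous_on (U \<times> {0<..<1}) (\<lambda>(u, p). f u p)"
    and bound: "\<And>u p. u \<in> U \<Longrightarrow> 0 < p \<Longrightarrow> p < 1 \<Longrightarrow> norm (f u p) \<le> B p"
    and B: "integrable unit_lborel B"
  shows "continuous_on U (\<lambda>u. \<integral>p. f u p \<partial>unit_lborel)"
  unfolding continuous_on_sequentially comp_def
proof safe
  fix x a assume xa: "a \<in> U" "\<forall>n. x n \<in> U" "x \<longlonglongrightarrow> a"
  have meas: "f u \<in> borel_measurable unit_lborel" if "u \<in> U" for u
  proof (rule borel_measurable_unit_lborel)
    have "continuous_on {0<..<1} (\<lambda>p. (\<lambda>(u, p). f u p) (u, p))"
      by (rule continuous_on_compose2[OF cont]) (use that in \<open>auto intro!: continuous_intros\<close>)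
    thus "continuous_on {0<..<1} (f u)" by simp
  qed
  show "(\<lambda>n. \<integral>p. f (x n) p \<partial>unit_lborel) \<longlonglongrightarrow> (\<integral>p. f a p \<partial>unit_lborel)"
  proof (rule integral_dominated_convergence[where w = B])
    show "AE p in unit_lborel. (\<lambda>n. f (x n) p) \<longlonglongrightarrow> f a p"
    proof (rule AE_I2)
      fix p assume "p \<in> space unit_lborel"
      hence p: "0 < p" "p < 1" by auto
      have "continuous_on U (\<lambda>u. (\<lambda>(u, p). f u p) (u, p))"
        by (rule continuous_on_compose2[OF cont]) (use p in \<open>auto intro!: continuous_intros\<close>)
      thus "(\<lambda>n. f (x n) p) \<longlonglongrightarrow> f a p"
        using xa by (auto simp: continuous_on_sequentially comp_def)
    qed
    show "AE p in unit_lborel. norm (f (x n) p) \<le> B p" for n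
      by (rule AE_I2) (use xa bound in auto)
  qed (use meas xa B in auto)
qed

lemma integral_unit_lborel_real:
  fixes f :: "real \<Rightarrow> real"
  assumes "set_integrable lborel {0..1} f"
  shows "integrable unit_lborel f" "(\<integral>p. f p \<partial>unit_lborel) = integral {0..1} f"
proof -
  have *: "set_integrable lborel {0<..<1} f"
    by (rule set_integrable_subset[OF assms]) auto
  thus "integrable unit_lborel f"
    by (simp add: integrable_restrict_space set_integrable_def)
  have "(\<integral>p. f p \<partial>unit_lborel) = (LINT p:{0<..<1}|lborel. f p)"
    by (simp add: integral_restrict_space set_lebesgue_integral_def)
  also have "\<dots> = integral {0<..<1} f"
    using set_borel_integral_eq_integral(2)[OF *] by simp
  also have "\<dots> = integral {0..1} f"
    by (simp add: integral_open_interval_real)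
  finally show "(\<integral>p. f p \<partial>unit_lborel) = integral {0..1} f" .
qed

lemma beta_integral_unit_lborel:
  fixes a b :: real
  assumes "a > 0" "b > 0"
  shows "integrable unit_lborel (\<lambda>p. p powr (a - 1) * (1 - p) powr (b - 1))"
    and "(\<integral>p. p powr (a - 1) * (1 - p) powr (b - 1) \<partial>unit_lborel) = Beta a b"
  using integral_unit_lborel_real[OF integrable_Beta[OF assms]] has_integral_Beta_real[OF assms]
  by (auto simp: integral_unique)

text \<open>On compact subintervals the Leibniz rule gives holomorphy. Since \<open>B\<close> does
  not depend on s, the part cut off is small uniformly on \<open>U\<close>, and locally uniform
  limits of holomorphic functions are holomorphic.\<close>

lemma integral_exp_holomorphic:
  fixes h :: "real \<Rightarrow> complex"
  assumes U: "open U" "convex U"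
    and h: "continuous_on {0<..<1} h"
    and bound: "\<And>s p. s \<in> U \<Longrightarrow> 0 < p \<Longrightarrow> p < 1 \<Longrightarrow> norm (exp (s * h p)) \<le> B p"
    and B: "integrable unit_lborel B"
  shows "(\<lambda>s. \<integral>p. exp (s * h p) \<partial>unit_lborel) holomorphic_on U"
proof -
  \<comment> \<open>The shift by 3 keeps the cutoffs strictly inside the unit interval, with
    \<open>a n < b n\<close>.\<close>
  define a b :: "nat \<Rightarrow> real" where "a = (\<lambda>n. 1 / (real n + 3))" and "b = (\<lambda>n. 1 - 1 / (real n + 3))"
  have ab: "0 < a n" "a n < 1" "0 < b n" "b n < 1" for n by (auto simp: a_def b_def field_simps)
  have sub: "cbox (a n) (b n) \<subseteq> {0<..<1}" for n
  proof
    fix x assume "x \<in> cbox (a n) (b n)"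
    thus "x \<in> {0<..<1}" using ab[of n] by auto
  qed
  have hn: "continuous_on (cbox (a n) (b n)) h" for n
    by (rule continuous_on_subset[OF h sub])
  define I where "I = (\<lambda>n s. \<integral>p. indicator {a n..b n} p *\<^sub>R exp (s * h p) \<partial>unit_lborel)"
  have I_eq: "I n s = integral (cbox (a n) (b n)) (\<lambda>p. exp (s * h p))" for n s
  proof -
    have int: "set_integrable lborel (cbox (a n) (b n)) (\<lambda>p. exp (s * h p))"
      unfolding set_integrable_def
      by (rule borel_integrable_compact) (auto intro!: continuous_intros hn[simplified])
    have "I n s = (LINT p|lborel. indicator {0<..<1} p *\<^sub>R indicator {a n..b n} p *\<^sub>R exp (s * h p))"
      unfolding I_def by (subst integral_restrict_space) auto
    also have "\<dots> = (LINT p:cbox (a n) (b n)|lborel. exp (s * h p))"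
      unfolding set_lebesgue_integral_def
      by (rule Bochner_Integration.integral_cong) (use sub[of n] in \<open>auto simp: indicator_def\<close>)
    finally show ?thesis using set_borel_integral_eq_integral(2)[OF int] by simp
  qed
  have hol: "I n holomorphic_on U" for n
    unfolding I_eq[abs_def]
  proof (rule leibniz_rule_holomorphic[where fx = "\<lambda>s p. h p * exp (s * h p)"])
    fix s t assume "s \<in> U"
    show "((\<lambda>s. exp (s * h t)) has_field_derivative h t * exp (s * h t)) (at s within U)"
      by (auto intro!: derivative_eq_intros)
    show "(\<lambda>p. exp (s * h p)) integrable_on cbox (a n) (b n)"
      by (intro integrable_continuous continuous_intros hn)
  next
    have "continuous_on (U \<times> cbox (a n) (b n)) (\<lambda>x. h (snd x))"
      by (rule continuous_on_compose2[OF hn]) (auto intro!: continuous_intros)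
    thus "continuous_on (U \<times> cbox (a n) (b n)) (\<lambda>(s, t). h t * exp (s * h t))"
      by (auto simp: case_prod_unfold intro!: continuous_intros)
  qed (use U in auto)
  define d where "d = (\<lambda>n. \<integral>p. indicator (- {a n..b n}) p * B p \<partial>unit_lborel)"
  have Bpos: "B p \<ge> 0" if "s \<in> U" "0 < p" "p < 1" for s p
    using bound[OF that] norm_ge_zero order_trans by blast
  have intB: "integrable unit_lborel (\<lambda>p. indicator (- {a n..b n}) p * B p)" for n
  proof (rule Bochner_Integration.integrable_bound[OF B])
    have "(indicator (- {a n..b n}) :: real \<Rightarrow> real) \<in> borel_measurable unit_lborel"
      by (rule measurable_restrict_space1) auto
    thus "(\<lambda>p. indicator (- {a n..b n}) p * B p) \<in> borel_measurable unit_lborel"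
      using B by (intro borel_measurable_times) auto
  qed (auto simp: indicator_def)
  have d: "d \<longlonglongrightarrow> 0"
  proof -
    have "d \<longlonglongrightarrow> (\<integral>p. 0 \<partial>unit_lborel)"
      unfolding d_def
    proof (rule integral_dominated_convergence[where w = "\<lambda>p. \<bar>B p\<bar>"])
      show "AE p in unit_lborel. (\<lambda>n. indicator (- {a n..b n}) p * B p) \<longlonglongrightarrow> 0"
      proof (rule AE_I2)
        fix p assume "p \<in> space unit_lborel"
        hence p: "0 < p" "p < 1" by auto
        have "a \<longlonglongrightarrow> 0" "b \<longlonglongrightarrow> 1" unfolding a_def b_def by real_asymp+
        hence "\<forall>\<^sub>F n in sequentially. a n < p" "\<forall>\<^sub>F n in sequentially. p < b n"
          using p by (auto intro: order_tendstoD)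
        hence "\<forall>\<^sub>F n in sequentially. indicator (- {a n..b n}) p * B p = 0"
          by eventually_elim auto
        thus "(\<lambda>n. indicator (- {a n..b n}) p * B p) \<longlonglongrightarrow> 0" by (rule tendsto_eventually)
      qed
    qed (use B intB in \<open>auto simp: indicator_def\<close>)
    thus ?thesis by simp
  qed
  have meas: "(\<lambda>p. exp (s * h p)) \<in> borel_measurable unit_lborel" for s
    by (rule borel_measurable_unit_lborel) (intro continuous_intros h)
  have int: "integrable unit_lborel (\<lambda>p. exp (s * h p))" if "s \<in> U" for s
    by (rule Bochner_Integration.integrable_bound[OF B meas])
       (use bound[OF that] Bpos[OF that] in \<open>auto intro!: AE_I2\<close>)
  have dist: "norm (I n s - (\<integral>p. exp (s * h p) \<partial>unit_lborel)) \<le> d n" if "s \<in> U" for n s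
  proof -
    have int': "integrable unit_lborel (\<lambda>p. indicator {a n..b n} p *\<^sub>R exp (s * h p))"
      by (rule integrable_mult_indicator[OF _ int[OF that]])
         (use sub[of n] in \<open>auto simp: sets_restrict_space_iff\<close>)
    have "I n s - (\<integral>p. exp (s * h p) \<partial>unit_lborel) =
       (\<integral>p. indicator {a n..b n} p *\<^sub>R exp (s * h p) - exp (s * h p) \<partial>unit_lborel)"
      unfolding I_def using int' int[OF that] by simp
    also have "norm \<dots> \<le> d n"
      unfolding d_def
      by (rule Bochner_Integration.integral_norm_bound_integral[OF _ intB])
         (use int' int[OF that] bound[OF that] in \<open>auto simp: indicator_def\<close>)
    finally show ?thesis .
  qed
  have unif: "uniform_limit U I (\<lambda>s. \<integral>p. exp (s * h p) \<partial>unit_lborel) sequentially"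
  proof (rule uniform_limitI)
    fix e :: real assume "e > 0"
    hence "\<forall>\<^sub>F n in sequentially. d n < e" by (intro order_tendstoD(2)[OF d])
    thus "\<forall>\<^sub>F n in sequentially. \<forall>s\<in>U. dist (I n s) (\<integral>p. exp (s * h p) \<partial>unit_lborel) < e"
      by eventually_elim (use dist in \<open>auto simp: dist_norm intro: le_less_trans\<close>)
  qed
  show ?thesis
  proof (rule holomorphic_uniform_sequence[OF U(1) hol])
    fix x assume "x \<in> U"
    then obtain r where "r > 0" "cball x r \<subseteq> U" using U open_contains_cball by blast
    thus "\<exists>d>0. cball x d \<subseteq> U \<and> uniform_limit (cball x d) I (\<lambda>s. \<integral>p. exp (s * h p) \<partial>unit_lborel) sequentially"
      using uniform_limit_on_subset[OF unif] by blast
  qed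
qed

section \<open>The Beta integral of powers of p / (1 - p)\<close>

definition logit :: "real \<Rightarrow> real" where "logit p = ln p - ln (1 - p)"

lemma continuous_on_logit [continuous_intros]:
  "continuous_on A f \<Longrightarrow> (\<And>x. x \<in> A \<Longrightarrow> 0 < f x \<and> f x < 1) \<Longrightarrow> continuous_on A (\<lambda>x. logit (f x))"
  unfolding logit_def by (auto intro!: continuous_intros) (metis less_irrefl)+

text \<open>Both logarithms are nonpositive, so |logit p| is at most minus their sum. One Beta
  integrand, integrable for \<open>\<rho> < 1\<close>, thus serves a whole strip of
  exponents.\<close>

lemma exp_abs_logit_le:
  assumes "0 < p" "p < 1" "\<bar>c\<bar> \<le> \<rho>"
  shows "exp (c * logit p) \<le> p powr (-\<rho>) * (1 - p) powr (-\<rho>)"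
proof -
  have ln: "ln p \<le> 0" "ln (1 - p) \<le> 0" using assms by auto
  have "\<bar>c * logit p\<bar> \<le> \<rho> * \<bar>logit p\<bar>"
    using assms by (simp add: abs_mult mult_right_mono)
  also have "\<dots> \<le> \<rho> * (- ln p - ln (1 - p))"
  proof (rule mult_left_mono)
    show "\<bar>logit p\<bar> \<le> - ln p - ln (1 - p)" using ln unfolding logit_def by linarith
  qed (use assms in linarith)
  finally have "c * logit p \<le> -\<rho> * ln p + -\<rho> * ln (1 - p)" by (simp add: algebra_simps)
  hence "exp (c * logit p) \<le> exp (-\<rho> * ln p) * exp (-\<rho> * ln (1 - p))"
    by (simp flip: exp_add)
  thus ?thesis using assms by (simp add: powr_def mult_ac)
qed

text \<open>For real c in (0, 1) the integral is Beta(1+c, 1-c) = c Gamma(c) Gamma(1-c), and the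
  reflection formula evaluates it; analytic continuation does the rest. Multiplying by the sine
  keeps c = 0 in the statement.\<close>

lemma integral_exp_logit:
  fixes c :: complex
  assumes "\<bar>Re c\<bar> < 1"
  shows "sin (of_real pi * c) * (\<integral>p. exp (c * of_real (logit p)) \<partial>unit_lborel) = of_real pi * c"
proof -
  \<comment> \<open>A slightly narrower strip, on all of which one integrable majorant is
    valid.\<close>
  obtain \<rho> where rho: "\<bar>Re c\<bar> < \<rho>" "\<rho> < 1" using assms dense by blast
  define U where "U = {c. Re c < \<rho>} \<inter> {c. Re c > - \<rho>}"
  have U: "open U" "convex U"
    unfolding U_def by (auto intro!: open_halfspace_Re_lt open_halfspace_Re_gt
        convex_Int convex_halfspace_Re_lt convex_halfspace_Re_gt)
  define F :: "complex \<Rightarrow> complex" where "F = (\<lambda>c. \<integral>p. exp (c * of_real (logit p)) \<partial>unit_lborel)"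
  have "F holomorphic_on U"
    unfolding F_def
  proof (rule integral_exp_holomorphic[where h = "\<lambda>p. of_real (logit p)" and B = "\<lambda>p. p powr (-\<rho>) * (1 - p) powr (-\<rho>)"])
    show "integrable unit_lborel (\<lambda>p. p powr (-\<rho>) * (1 - p) powr (-\<rho>))"
      using beta_integral_unit_lborel(1)[of "1 - \<rho>" "1 - \<rho>"] rho by simp
    show "norm (exp (s * of_real (logit p))) \<le> p powr (-\<rho>) * (1 - p) powr (-\<rho>)"
      if "s \<in> U" "0 < p" "p < 1" for s p
      using exp_abs_logit_le[of p "Re s" \<rho>] that by (auto simp: U_def norm_exp_eq_Re)
  qed (use U in \<open>auto intro!: continuous_intros\<close>)
  hence hol: "(\<lambda>c. sin (of_real pi * c) * F c) holomorphic_on U"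
    by (intro holomorphic_intros)
  have real: "sin (of_real pi * of_real x) * F (of_real x) = of_real pi * of_real x"
    if x: "0 < x" "x < 1" for x
  proof -
    have "F (of_real x) = (\<integral>p. of_real (p powr ((1 + x) - 1) * (1 - p) powr ((1 - x) - 1)) \<partial>unit_lborel)"
      unfolding F_def
    proof (rule Bochner_Integration.integral_cong[OF refl])
      fix p assume "p \<in> space unit_lborel"
      hence p: "0 < p" "p < 1" by auto
      have "exp (of_real x * of_real (logit p)) = complex_of_real (exp (x * logit p))"
        by (simp flip: exp_of_real)
      also have "exp (x * logit p) = p powr x * (1 - p) powr (-x)"
        using p by (simp add: powr_def logit_def algebra_simps exp_diff exp_minus divide_inverse)
      finally show "exp (of_real x * of_real (logit p)) = 
          complex_of_real (p powr ((1 + x) - 1) * (1 - p) powr ((1 - x) - 1))" by simp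
    qed
    also have "\<dots> = of_real (Beta (1 + x) (1 - x))"
      using beta_integral_unit_lborel(2)[of "1+x" "1-x"] x by (subst integral_complex_of_real) simp
    also have "\<dots> = Beta (1 + of_real x) (1 - of_real x)"
      by (simp flip: Beta_complex_of_real)
    also have "\<dots> = of_real x * (Gamma (of_real x) * Gamma (1 - of_real x))"
    proof -
      have "complex_of_real x \<noteq> 0" using x by simp
      hence "Gamma (complex_of_real x + 1) = of_real x * Gamma (of_real x)"
        using x by (intro Gamma_plus1) (auto simp: nonpos_Ints_def complex_eq_iff)
      moreover have "Gamma (2::complex) = 1" using Gamma_fact[of 1, where ?'a = complex] by simp
      ultimately show ?thesis by (simp add: Beta_def add_ac)
    qed
    also have "Gamma (of_real x) * Gamma (1 - of_real x) = of_real pi / sin (of_real pi * complex_of_real x)"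
      by (rule Gamma_reflection_complex)
    finally show ?thesis
    proof -
      assume *: "F (of_real x) = of_real x * (of_real pi / sin (of_real pi * complex_of_real x))"
      have "sin (pi * x) > 0" using x by (intro sin_gt_zero) auto
      hence "sin (of_real pi * complex_of_real x) \<noteq> 0"
        by (metis less_irrefl of_real_mult of_real_eq_0_iff sin_of_real)
      thus ?thesis by (simp add: *)
    qed
  qed
  \<comment> \<open>Identity theorem: the zeros on the real segment accumulate at 0, which lies in
    the strip.\<close>
  have "sin (of_real pi * c) * F c - of_real pi * c = 0"
  proof (rule analytic_continuation[where f = "\<lambda>c. sin (of_real pi * c) * F c - of_real pi * c" and w = c and U = "complex_of_real ` {0<..<\<rho>}" and S = U and \<xi> = 0])
    show "(\<lambda>c. sin (of_real pi * c) * F c - of_real pi * c) holomorphic_on U"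
      by (intro holomorphic_intros hol)
    show "0 islimpt complex_of_real ` {0<..<\<rho>}"
      unfolding islimpt_approachable
    proof (intro allI impI)
      fix e :: real assume "e > 0"
      hence "min (e/2) (\<rho>/2) \<in> {0<..<\<rho>}" "norm (complex_of_real (min (e/2) (\<rho>/2))) < e"
        using rho by (auto simp: min_def)
      thus "\<exists>x'\<in>complex_of_real ` {0<..<\<rho>}. x' \<noteq> 0 \<and> dist x' 0 < e"
        by (intro bexI[of _ "of_real (min (e/2) (\<rho>/2))"]) auto
    qed
  qed (use rho U real in \<open>auto simp: U_def convex_connected\<close>)
  thus ?thesis by (simp add: F_def)
qed

section \<open>Powers of (1 - e^(-\<epsilon>x)) / \<epsilon> down to \<epsilon> = 0\<close>

definition expm_quot :: "complex \<Rightarrow> complex" where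
  "expm_quot w = (if w = 0 then 1 else (1 - exp (-w)) / w)"

lemma continuous_on_expm_quot [continuous_intros]:
  "continuous_on A f \<Longrightarrow> continuous_on A (\<lambda>x. expm_quot (f x))"
proof -
  have "isCont expm_quot w" for w
  proof (cases "w = 0")
    case False
    have "(\<lambda>w. (1 - exp (-w)) / w) \<midarrow>w\<rightarrow> (1 - exp (-w)) / w"
      by (intro tendsto_intros False)
    moreover have "\<forall>\<^sub>F v in nhds w. v \<in> - {0}"
      by (rule eventually_nhds_in_open) (use False in auto)
    hence "\<forall>\<^sub>F v in at w. (1 - exp (-v)) / v = expm_quot v"
      unfolding eventually_at_filter by eventually_elim (auto simp: expm_quot_def)
    ultimately have "expm_quot \<midarrow>w\<rightarrow> (1 - exp (-w)) / w"
      by (rule Lim_transform_eventually)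
    thus ?thesis using False by (simp add: isCont_def expm_quot_def)
  next
    case True
    have "((\<lambda>w::complex. 1 - exp (-w)) has_field_derivative 1) (at 0)"
      by (auto intro!: derivative_eq_intros)
    hence "(\<lambda>w::complex. (1 - exp (-w)) / w) \<midarrow>0\<rightarrow> 1"
      by (simp add: has_field_derivative_iff)
    moreover have "\<forall>\<^sub>F v in at 0. (1 - exp (-v)) / v = expm_quot v"
      by (auto simp: eventually_at_filter expm_quot_def)
    ultimately have "expm_quot \<midarrow>0\<rightarrow> 1"
      by (rule Lim_transform_eventually)
    thus ?thesis using True by (simp add: isCont_def expm_quot_def)
  qed
  moreover assume "continuous_on A f"
  ultimately show ?thesis
    by (intro continuous_on_compose2[of UNIV expm_quot A f]) (auto intro: continuous_at_imp_continuous_on)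
qed

text \<open>The factored form includes \<open>\<epsilon> = 0\<close>, and its joint continuity in
  \<open>\<epsilon>\<close> and x is inherited from \<open>expm_quot\<close>.\<close>

definition expm_arc :: "real \<Rightarrow> complex \<Rightarrow> complex" where
  "expm_arc \<epsilon> x = x * expm_quot (of_real \<epsilon> * x)"

lemma expm_arc_0 [simp]: "expm_arc 0 x = x"
  by (simp add: expm_arc_def expm_quot_def)

lemma expm_arc_pos: "\<epsilon> > 0 \<Longrightarrow> expm_arc \<epsilon> x = (1 - exp (- of_real \<epsilon> * x)) / of_real \<epsilon>"
  by (simp add: expm_arc_def expm_quot_def)

lemma Re_expm_pos: "Re x > 0 \<Longrightarrow> Re (1 - exp (-x)) > 0"
proof -
  assume "Re x > 0"
  hence "norm (exp (-x)) < 1" by (simp add: norm_exp_eq_Re)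
  hence "Re (exp (-x)) < 1" using complex_Re_le_cmod[of "exp (-x)"] by linarith
  thus ?thesis by simp
qed

text \<open>Keeps the base of \<open>gpow\<close> away from the cut of the principal power.\<close>

lemma Re_expm_arc_pos:
  assumes "\<epsilon> \<ge> 0" "Re x > 0"
  shows "Re (expm_arc \<epsilon> x) > 0"
proof (cases "\<epsilon> = 0")
  case False
  hence "\<epsilon> > 0" using assms by simp
  thus ?thesis using assms Re_expm_pos[of "of_real \<epsilon> * x"] by (simp add: expm_arc_pos)
qed (use assms in auto)

text \<open>For \<open>\<epsilon> > 0\<close> this is \<open>((e\<^bsup>\<epsilon>x\<^esup> - 1) / \<epsilon>)\<^bsup>-w\<^esup>\<close>, on the branch that is continuous on the right
  half-plane; \<open>\<epsilon> = 0\<close> is the continuous extension \<open>x\<^bsup>-w\<^esup>\<close>.\<close>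

definition gpow :: "real \<Rightarrow> complex \<Rightarrow> complex \<Rightarrow> complex" where
  "gpow \<epsilon> w x = exp (- w * of_real \<epsilon> * x) * expm_arc \<epsilon> x powr (-w)"

lemma continuous_on_gpow:
  assumes "continuous_on A e" "continuous_on A w" "continuous_on A x"
    "\<And>a. a \<in> A \<Longrightarrow> e a \<ge> 0" "\<And>a. a \<in> A \<Longrightarrow> Re (x a) > 0"
  shows "continuous_on A (\<lambda>a. gpow (e a) (w a) (x a))"
proof -
  have c: "continuous_on A (\<lambda>a. expm_arc (e a) (x a))"
    unfolding expm_arc_def by (intro continuous_intros assms)
  have p: "Re (expm_arc (e a) (x a)) > 0" if "a \<in> A" for a
    using Re_expm_arc_pos assms that by blast
  show ?thesis unfolding gpow_def
    by (intro continuous_intros assms continuous_on_powr_complex c) (use p in force)+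
qed

lemma gpow_0: "gpow 0 w x = x powr (-w)"
  by (simp add: gpow_def)

lemma gpow_1: "gpow 1 w x = exp (- w * x) * (1 - exp (-x)) powr (-w)"
  by (simp add: gpow_def expm_arc_pos)

text \<open>The power of a product splits here because \<open>\<epsilon>\<close> is a positive real
  and does not change the argument. A summand at \<open>\<epsilon>\<close> x is thereby turned into
  one that is continuous at \<open>\<epsilon> = 0\<close>.\<close>

lemma gpow_scale:
  assumes "\<epsilon> > 0" "Re x > 0"
  shows "of_real \<epsilon> powr w * gpow 1 w (of_real \<epsilon> * x) = gpow \<epsilon> w x"
proof -
  have *: "1 - exp (- (of_real \<epsilon> * x)) = of_real \<epsilon> * expm_arc \<epsilon> x"
    using assms by (simp add: expm_arc_pos)
  have "gpow 1 w (of_real \<epsilon> * x) = exp (- w * of_real \<epsilon> * x) * (of_real \<epsilon> * expm_arc \<epsilon> x) powr (-w)"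
    unfolding gpow_1 * by (simp add: mult_ac)
  moreover have "expm_arc \<epsilon> x \<noteq> 0" using Re_expm_arc_pos[of \<epsilon> x] assms by force
  ultimately show ?thesis
    using assms by (simp add: gpow_def powr_def Ln_times_of_real Ln_of_real algebra_simps flip: exp_add)
qed

section \<open>The primitive \<open>inc_beta\<close> and its recurrence\<close>

definition inc_beta :: "complex \<Rightarrow> complex \<Rightarrow> complex" where
  "inc_beta w x = exp (- w * x) * ibeta w (exp (-x))"

text \<open>The chain rule at u = e^(-x) applied to the differential equation of
  \<open>ibeta\<close>. Thus \<open>inc_beta w\<close> is the P_w of the overview; its factor u^w is
  written exp (-w x), which involves no branch.\<close>

lemma inc_beta_has_field_derivative:
  assumes x: "Re x > 0" and w: "\<And>r. w \<noteq> - of_nat r"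
  shows "(inc_beta w has_field_derivative - gpow 1 w x) (at x)"
proof -
  have "norm (exp (-x)) < 1" using x by (simp add: norm_exp_eq_Re)
  then obtain d where d: "(ibeta w has_field_derivative d) (at (exp (-x)))"
      "exp (-x) * d + w * ibeta w (exp (-x)) = (1 - exp (-x)) powr (-w)"
    using ibeta_has_field_derivative[OF _ w] by metis
  have "((\<lambda>x. exp (- w * x) * ibeta w (exp (-x))) has_field_derivative
      (exp (- w * x) * (-w) * ibeta w (exp (-x)) + d * (exp (-x) * (-1)) * exp (- w * x))) (at x)"
    by (rule derivative_eq_intros refl DERIV_chain2[where f = "ibeta w" and g = "\<lambda>x. exp (-x)", OF d(1)])+ simp
  moreover have "exp (- w * x) * (-w) * ibeta w (exp (-x)) + d * (exp (-x) * (-1)) * exp (- w * x)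
       = - gpow 1 w x"
    unfolding gpow_1 d(2)[symmetric] by (simp add: algebra_simps)
  ultimately show ?thesis unfolding inc_beta_def[abs_def] by simp
qed

lemma inc_beta_recurrence:
  assumes x: "Re x > 0" and w: "\<And>r. w \<noteq> - of_nat r"
  shows "w * (inc_beta w x + inc_beta (w + 1) x) = gpow 1 w x"
proof -
  have "norm (exp (-x)) < 1" using x by (simp add: norm_exp_eq_Re)
  note ibeta_recurrence[OF this w, symmetric]
  moreover have "exp (- (w + 1) * x) = exp (- w * x) * exp (-x)"
    by (simp add: algebra_simps flip: exp_add)
  ultimately show ?thesis
    unfolding gpow_1 inc_beta_def by (simp add: algebra_simps)
qed

section \<open>Limit of the primitive at the origin\<close>

lemma has_integral_unit_lborel:
  fixes f :: "real \<Rightarrow> complex"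
  assumes "integrable unit_lborel f"
  shows "(f has_integral (\<integral>p. f p \<partial>unit_lborel)) {0..1}"
proof -
  have *: "set_integrable lborel {0<..<1} f"
    using assms by (simp add: integrable_restrict_space set_integrable_def)
  have "(\<integral>p. f p \<partial>unit_lborel) = (LINT p:{0<..<1}|lborel. f p)"
    by (simp add: integral_restrict_space set_lebesgue_integral_def)
  hence "(f has_integral (\<integral>p. f p \<partial>unit_lborel)) {0<..<1}"
    using set_borel_integral_eq_integral[OF *] by (metis integrable_integral)
  thus ?thesis by (simp add: has_integral_Icc_iff_Ioo)
qed

lemma integrable_unit_lborel_dominated:
  fixes f :: "real \<Rightarrow> complex"
  assumes "continuous_on {0<..<1} f" "\<And>p. 0 < p \<Longrightarrow> p < 1 \<Longrightarrow> norm (f p) \<le> B p" "integrable unit_lborel B"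
  shows "integrable unit_lborel f"
proof (rule Bochner_Integration.integrable_bound[OF assms(3)])
  show "f \<in> borel_measurable unit_lborel" by (rule borel_measurable_unit_lborel[OF assms(1)])
  show "AE p in unit_lborel. norm (f p) \<le> norm (B p)"
    by (rule AE_I2) (use assms(2) in \<open>fastforce intro: order_trans\<close>)
qed

lemma integrable_exp_logit:
  assumes "\<bar>Re c\<bar> < 1"
  shows "integrable unit_lborel (\<lambda>p. exp (c * of_real (logit p)))"
proof (rule integrable_unit_lborel_dominated)
  show "integrable unit_lborel (\<lambda>p. p powr (-\<bar>Re c\<bar>) * (1 - p) powr (-\<bar>Re c\<bar>))"
    using beta_integral_unit_lborel(1)[of "1 - \<bar>Re c\<bar>" "1 - \<bar>Re c\<bar>"] assms by simp
  show "norm (exp (c * of_real (logit p))) \<le> p powr (-\<bar>Re c\<bar>) * (1 - p) powr (-\<bar>Re c\<bar>)"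
    if "0 < p" "p < 1" for p
    using exp_abs_logit_le[of p "Re c" "\<bar>Re c\<bar>"] that by (simp add: norm_exp_eq_Re)
qed (auto intro!: continuous_intros)

text \<open>Integration by parts: both sides have the derivative w t^(w-1) (1-t)^(-w) in t. Unlike
  that derivative, the integrand on the right stays integrable at 0 for -1 < Re w <= 0.\<close>

lemma ibeta_eq_integral:
  fixes w :: complex and t :: real
  assumes w: "\<bar>Re w\<bar> < 1" "w \<noteq> 0" and t: "0 < t" "t < 1"
  shows "w * (of_real t powr w * ibeta w (of_real t)) =
    of_real t powr w * (1 - of_real t) powr (1 - w) + integral {0..t} (\<lambda>p. exp (w * of_real (logit p)))"
proof -
  have w1: "w + 1 \<noteq> - of_nat r" for r
  proof
    assume "w + 1 = - of_nat r"
    hence "Re w + 1 = - real r" by (metis Re_complex_of_real of_real_of_nat_eq uminus_complex.sel(1) plus_complex.sel(1) one_complex.sel(1))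
    thus False using w by linarith
  qed
  have w0: "w \<noteq> - of_nat r" for r
  proof
    assume *: "w = - of_nat r"
    hence "Re w = - real r" by simp
    hence "r = 0" using w by (cases r) auto
    thus False using w * by simp
  qed
  \<comment> \<open>By \<open>ibeta_recurrence\<close> this is w u^w ibeta w u - u^w (1-u)^(1-w) for
    0 < u < 1. Written with w + 1 it is continuous at 0 with value 0, since Re (w + 1) > 0.\<close>
  define \<Theta> where "\<Theta> = (\<lambda>u. u powr (w + 1) * (1 - u) powr (-w) - w * (u powr (w + 1) * ibeta (w + 1) u))"
  have deriv: "((\<lambda>\<tau>. \<Theta> (of_real \<tau>)) has_vector_derivative exp (w * of_real (logit \<tau>))) (at \<tau>)"
    if \<tau>: "0 < \<tau>" "\<tau> < 1" for \<tau> :: real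
  proof -
    define u where "u = complex_of_real \<tau>"
    have u: "u \<notin> \<real>\<^sub>\<le>\<^sub>0" "1 - u \<notin> \<real>\<^sub>\<le>\<^sub>0" "u \<noteq> 0" "1 - u \<noteq> 0" "norm u < 1"
      using \<tau> unfolding u_def by (auto simp: complex_nonpos_Reals_iff complex_eq_iff)
    obtain d where d: "(ibeta (w+1) has_field_derivative d) (at u)"
      "u * d + (w + 1) * ibeta (w + 1) u = (1 - u) powr (- (w + 1))"
      using ibeta_has_field_derivative[OF u(5) w1] by metis
    define A B where "A = u powr w" and "B = (1 - u) powr (- w - 1)"
    have A: "u powr (w + 1) = A * u" using u by (simp add: A_def powr_add)
    have B: "(1 - u) powr (-w) = B * (1 - u)"
    proof -
      have "(1 - u) powr (-w) = (1 - u) powr (-w - 1 + 1)" by simp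
      also have "\<dots> = B * (1 - u)" using u by (subst powr_add) (simp add: B_def)
      finally show ?thesis .
    qed
    have "(\<Theta> has_field_derivative (((w + 1) * u powr (w + 1 - 1)) * (1 - u) powr (-w)
            + (-w) * (1 - u) powr (-w - 1) * (-1) * u powr (w + 1)
            - w * (((w + 1) * u powr (w + 1 - 1)) * ibeta (w + 1) u + d * u powr (w + 1)))) (at u)"
      unfolding \<Theta>_def
      by (rule derivative_eq_intros refl d(1) has_field_derivative_powr
            DERIV_chain2[where f = "\<lambda>z. z powr (-w)" and g = "\<lambda>u. 1 - u"] u)+ auto
    also have "((w + 1) * u powr (w + 1 - 1)) * (1 - u) powr (-w)
            + (-w) * (1 - u) powr (-w - 1) * (-1) * u powr (w + 1)
            - w * (((w + 1) * u powr (w + 1 - 1)) * ibeta (w + 1) u + d * u powr (w + 1))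
        = (w + 1) * A * (B * (1 - u)) + w * B * (A * u) - w * A * (u * d + (w + 1) * ibeta (w + 1) u)"
    proof -
      have A': "u powr (w + 1 - 1) = A" and B': "(1 - u) powr (- w - 1) = B"
        by (simp_all add: A_def B_def)
      show ?thesis unfolding A B A' B' by (simp add: algebra_simps)
    qed
    also have "\<dots> = A * (B * (1 - u))"
    proof -
      have "- (w + 1) = - w - 1" by simp
      hence "u * d + (w + 1) * ibeta (w + 1) u = B" using d(2) by (simp only: B_def)
      thus ?thesis by (simp add: algebra_simps)
    qed
    also have "\<dots> = exp (w * of_real (logit \<tau>))"
    proof -
      have "1 - u = of_real (1 - \<tau>)" by (simp add: u_def)
      hence "Ln (1 - u) = of_real (ln (1 - \<tau>))" "Ln u = of_real (ln \<tau>)"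
        using \<tau> by (simp_all add: u_def Ln_of_real del: of_real_diff)
      thus ?thesis unfolding B[symmetric] A_def using u
        by (simp add: powr_def logit_def algebra_simps flip: exp_add)
    qed
    finally show ?thesis
      unfolding u_def by (rule has_vector_derivative_real_field)
  qed
  have cont: "continuous_on {0..t} (\<lambda>\<tau>. \<Theta> (of_real \<tau>))"
  proof -
    have ib: "continuous_on {0..t} (\<lambda>\<tau>. ibeta (w + 1) (of_real \<tau>))"
    proof (rule continuous_on_compose2[where t = "ball 0 1" and g = "ibeta (w + 1)" and f = of_real])
      show "continuous_on (ball 0 1) (ibeta (w + 1))"
      proof (rule continuous_at_imp_continuous_on, rule ballI)
        fix u :: complex assume "u \<in> ball 0 1"
        thus "isCont (ibeta (w + 1)) u"
          using ibeta_has_field_derivative[OF _ w1, of u] DERIV_isCont by (metis mem_ball_0)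
      qed
    qed (use t in \<open>auto intro!: continuous_intros\<close>)
    show ?thesis
      unfolding \<Theta>_def
      by (intro continuous_intros continuous_on_powr_complex ib)
         (use t w in \<open>auto simp: complex_eq_iff\<close>)
  qed
  have "((\<lambda>p. exp (w * of_real (logit p))) has_integral (\<Theta> (of_real t) - \<Theta> (of_real 0))) {0..t}"
    using t by (intro fundamental_theorem_of_calculus_interior cont deriv) auto
  moreover have "\<Theta> 0 = 0" by (simp add: \<Theta>_def)
  ultimately have I: "integral {0..t} (\<lambda>p. exp (w * of_real (logit p))) = \<Theta> (of_real t)"
    by (simp add: integral_unique)
  define u where "u = complex_of_real t"
  have u: "u \<noteq> 0" "1 - u \<noteq> 0" "norm u < 1" using t by (auto simp: u_def complex_eq_iff)
  have "w * (u powr w * ibeta w u) = u powr w * ((1 - u) powr (-w) - w * (u * ibeta (w + 1) u))"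
    unfolding ibeta_recurrence[OF u(3) w0, symmetric] by (simp add: algebra_simps)
  also have "\<dots> = u powr w * (1 - u) powr (1 - w) + \<Theta> u"
  proof -
    have "(1 - u) powr (1 - w) = (1 - u) powr (1 + (- w))" by simp
    also have "\<dots> = (1 - u) * (1 - u) powr (- w)" using u by (subst powr_add) simp
    finally have 1: "(1 - u) powr (1 - w) = (1 - u) * (1 - u) powr (- w)" .
    have 2: "u powr (w + 1) = u powr w * u" using u by (simp add: powr_add)
    show ?thesis unfolding \<Theta>_def 1 2 by (simp add: algebra_simps)
  qed
  finally show ?thesis unfolding I u_def .
qed

lemma tendsto_integral_exp_logit:
  fixes w :: complex
  assumes "\<bar>Re w\<bar> < 1"
  shows "((\<lambda>x. integral {0..exp (-x)} (\<lambda>p. exp (w * of_real (logit p)))) \<longlongrightarrow>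
           (\<integral>p. exp (w * of_real (logit p)) \<partial>unit_lborel)) (at_right 0)"
proof -
  note I = has_integral_unit_lborel[OF integrable_exp_logit[OF assms]]
  have a: "continuous_on {0..1} (\<lambda>t. integral {0..t} (\<lambda>p. exp (w * of_real (logit p))))"
    by (rule indefinite_integral_continuous_1) (use I in blast)
  have b: "((\<lambda>x::real. exp (-x)) \<longlongrightarrow> 1) (at_right 0)"
    by (auto intro!: tendsto_eq_intros)
  have c: "\<forall>\<^sub>F x::real in at_right 0. exp (-x) \<in> {0..1}"
    by (auto simp: eventually_at_filter)
  have "((\<lambda>x. integral {0..exp (-x)} (\<lambda>p. exp (w * of_real (logit p)))) \<longlongrightarrow>
     integral {0..1} (\<lambda>p. exp (w * of_real (logit p)))) (at_right 0)"
    by (rule continuous_on_tendsto_compose[OF a b _ c]) auto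
  thus ?thesis using I by (simp add: integral_unique)
qed

lemma tendsto_expm_powr_0:
  assumes "Re c > 0"
  shows "((\<lambda>x. (1 - exp (- complex_of_real x)) powr c) \<longlongrightarrow> 0) (at_right 0)"
proof -
  have "continuous_on {0..} (\<lambda>x. (1 - exp (- complex_of_real x)) powr c)"
    using assms by (intro continuous_intros continuous_on_powr_complex) (auto simp: Re_exp)
  hence "((\<lambda>x. (1 - exp (- complex_of_real x)) powr c) \<longlongrightarrow> (1 - exp (- complex_of_real 0)) powr c) (at 0 within {0..})"
    unfolding continuous_on_def by (rule bspec) auto
  thus ?thesis
    by (auto intro: tendsto_within_subset)
qed

text \<open>In \<open>ibeta_eq_integral\<close> with t = e^(-x) the boundary term tends to 0, as Re
  (1 - w) > 0, and the integral tends to the full one, pi w / sin (pi w).\<close>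

lemma tendsto_inc_beta_strip:
  assumes w: "\<bar>Re w\<bar> < 1" "w \<noteq> 0"
  shows "((\<lambda>x. inc_beta w (of_real x)) \<longlongrightarrow> of_real pi / sin (of_real pi * w)) (at_right 0)"
proof -
  have "((\<lambda>x. exp (- w * of_real x) * (1 - exp (- complex_of_real x)) powr (1 - w) +
        integral {0..exp (-x)} (\<lambda>p. exp (w * of_real (logit p)))) \<longlongrightarrow>
        exp (- w * of_real 0) * 0 + (\<integral>p. exp (w * of_real (logit p)) \<partial>unit_lborel)) (at_right 0)"
    by (intro tendsto_intros tendsto_integral_exp_logit tendsto_expm_powr_0) (use w in auto)
  moreover have "\<forall>\<^sub>F x in at_right 0. exp (- w * of_real x) * (1 - exp (- complex_of_real x)) powr (1 - w) +
        integral {0..exp (-x)} (\<lambda>p. exp (w * of_real (logit p))) = w * inc_beta w (of_real x)"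
  proof -
    have "exp (- w * of_real x) * (1 - exp (- complex_of_real x)) powr (1 - w) +
        integral {0..exp (-x)} (\<lambda>p. exp (w * of_real (logit p))) = w * inc_beta w (of_real x)" if "x > 0" for x
    proof -
      have "of_real (exp (-x)) powr w = exp (- w * of_real x)"
        by (simp add: powr_def Ln_of_real mult_ac)
      thus ?thesis
        using ibeta_eq_integral[OF w, of "exp (-x)"] that
        by (simp add: inc_beta_def exp_of_real[symmetric])
    qed
    thus ?thesis by (auto simp: eventually_at_filter)
  qed
  ultimately have "((\<lambda>x. w * inc_beta w (of_real x)) \<longlongrightarrow>
       exp (- w * of_real 0) * 0 + (\<integral>p. exp (w * of_real (logit p)) \<partial>unit_lborel)) (at_right 0)"
    by (rule Lim_transform_eventually)
  hence "((\<lambda>x. w * inc_beta w (of_real x)) \<longlongrightarrow> of_real pi * w / sin (of_real pi * w)) (at_right 0)"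
  proof -
    \<comment> \<open>The sine cannot vanish, because its product with the integral is pi w.\<close>
    have "of_real pi * w \<noteq> 0" using w by simp
    hence "sin (of_real pi * w) \<noteq> 0" using integral_exp_logit[OF w(1)] by auto
    hence "(\<integral>p. exp (w * of_real (logit p)) \<partial>unit_lborel) = of_real pi * w / sin (of_real pi * w)"
      using integral_exp_logit[OF w(1)] by (simp add: field_simps)
    thus ?thesis using \<open>((\<lambda>x. w * inc_beta w (of_real x)) \<longlongrightarrow> exp (- w * of_real 0) * 0 + _) (at_right 0)\<close>
      by simp
  qed
  from tendsto_divide[OF this tendsto_const[of w]] show ?thesis using w by simp
qed

text \<open>Moves left from the strip by unit steps. The recurrence gives the value at w from that
  at w + 1 with a change of sign; its \<open>gpow\<close> term tends to 0, and the shifted sine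
  changes sign as well.\<close>

lemma tendsto_inc_beta:
  assumes "Re w < 1" "\<And>r. w \<noteq> - of_nat r"
  shows "((\<lambda>x. inc_beta w (of_real x)) \<longlongrightarrow> of_real pi / sin (of_real pi * w)) (at_right 0)"
proof -
  obtain n :: nat where "Re w > - real n - 1"
  proof -
    obtain n :: nat where "- Re w - 1 < real n" using reals_Archimedean2 by blast
    thus ?thesis by (intro that[of n]) linarith
  qed
  with assms show ?thesis
  proof (induction n arbitrary: w)
    case 0
    have "w \<noteq> 0" using 0(2)[of 0] by simp
    thus ?case using 0 by (intro tendsto_inc_beta_strip) auto
  next
    case (Suc n)
    have w0: "w \<noteq> 0" using Suc.prems(2)[of 0] by simp
    show ?case
    proof (cases "Re w > -1")
      case True
      thus ?thesis using Suc.prems w0 by (intro tendsto_inc_beta_strip) auto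
    next
      case False
      have "w + 1 \<noteq> - of_nat r" for r
        using Suc.prems(2)[of "Suc r"] by (auto simp: algebra_simps eq_neg_iff_add_eq_0)
      hence IH: "((\<lambda>x. inc_beta (w + 1) (of_real x)) \<longlongrightarrow> of_real pi / sin (of_real pi * (w + 1))) (at_right 0)"
        using Suc.prems False by (intro Suc.IH) auto
      have "((\<lambda>x. gpow 1 w (of_real x) / w - inc_beta (w + 1) (of_real x)) \<longlongrightarrow>
          exp (- w * of_real 0) * 0 / w - of_real pi / sin (of_real pi * (w + 1))) (at_right 0)"
        unfolding gpow_1 by (intro tendsto_intros IH tendsto_expm_powr_0 w0) (use False in auto)
      moreover have "\<forall>\<^sub>F x in at_right 0. gpow 1 w (of_real x) / w - inc_beta (w + 1) (of_real x) = inc_beta w (of_real x)"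
      proof -
        have "gpow 1 w (of_real x) / w - inc_beta (w + 1) (of_real x) = inc_beta w (of_real x)" if "x > 0" for x
          using inc_beta_recurrence[of "of_real x" w, OF _ Suc.prems(2)] that w0
          by (simp flip: inc_beta_recurrence[of "of_real x" w, OF _ Suc.prems(2)])
        thus ?thesis by (auto simp: eventually_at_filter)
      qed
      ultimately have "((\<lambda>x. inc_beta w (of_real x)) \<longlongrightarrow>
          exp (- w * of_real 0) * 0 / w - of_real pi / sin (of_real pi * (w + 1))) (at_right 0)"
        by (rule Lim_transform_eventually)
      moreover have "sin (of_real pi * (w + 1)) = - sin (of_real pi * w)"
        by (simp add: distrib_left sin_add flip: sin_of_real cos_of_real)
      ultimately show ?thesis by simp
    qed
  qed
qed

text \<open>By \<open>gpow_scale\<close>, multiplying by the power w of \<open>\<tau>\<close> gives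
  \<open>gpow \<tau> w v\<close>, which is continuous, hence bounded, on the compact set [0, 1] x K
  with \<open>\<tau> = 0\<close> included.\<close>

lemma gpow_segment_bound:
  assumes "compact K" "\<And>v. v \<in> K \<Longrightarrow> Re v > 0"
  obtains C where "C \<ge> 0" "\<And>\<tau> v. 0 < \<tau> \<Longrightarrow> \<tau> \<le> 1 \<Longrightarrow> v \<in> K \<Longrightarrow> norm (gpow 1 w (of_real \<tau> * v)) \<le> C * \<tau> powr (- Re w)"
proof -
  have "continuous_on ({0..1} \<times> K) (\<lambda>a. gpow (fst a) w (snd a))"
    by (intro continuous_on_gpow continuous_intros) (use assms in auto)
  hence "compact ((\<lambda>a. gpow (fst a) w (snd a)) ` ({0..1} \<times> K))"
    by (rule compact_continuous_image) (intro compact_Times assms compact_Icc)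
  then obtain C where C: "\<And>a. a \<in> {0..1} \<times> K \<Longrightarrow> norm (gpow (fst a) w (snd a)) \<le> C"
    by (meson bounded_iff compact_imp_bounded imageI)
  show ?thesis
  proof (rule that[of "max C 0"])
    fix \<tau> :: real and v assume *: "0 < \<tau>" "\<tau> \<le> 1" "v \<in> K"
    have "norm (of_real \<tau> powr w * gpow 1 w (of_real \<tau> * v)) \<le> C"
      using C[of "(\<tau>, v)"] * assms by (subst gpow_scale) auto
    hence "\<tau> powr Re w * norm (gpow 1 w (of_real \<tau> * v)) \<le> max C 0"
      using * by (simp add: norm_mult norm_powr_real_powr)
    thus "norm (gpow 1 w (of_real \<tau> * v)) \<le> max C 0 * \<tau> powr (- Re w)"
      using * by (simp add: powr_minus field_simps)
  qed auto
qed

text \<open>Transfers the limit from the real axis to any ray: between \<open>\<tau>\<close> and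
  \<open>\<tau>\<close> x the primitive changes by at most a constant times \<open>\<tau>\<close> to
  the power 1 - Re w, which tends to 0.\<close>

lemma tendsto_inc_beta_ray:
  assumes w: "Re w < 1" "\<And>r. w \<noteq> - of_nat r" and x: "Re x > 0"
  shows "((\<lambda>\<tau>. inc_beta w (of_real \<tau> * x)) \<longlongrightarrow> of_real pi / sin (of_real pi * w)) (at_right 0)"
proof -
  have K: "Re v > 0" if "v \<in> closed_segment 1 x" for v
  proof -
    have "closed_segment 1 x \<subseteq> {v. Re v > 0}"
      by (rule closed_segment_subset) (use x in \<open>auto simp: convex_halfspace_Re_gt\<close>)
    thus ?thesis using that by auto
  qed
  obtain C where C: "C \<ge> 0"
    "\<And>\<tau> v. 0 < \<tau> \<Longrightarrow> \<tau> \<le> 1 \<Longrightarrow> v \<in> closed_segment 1 x \<Longrightarrow> norm (gpow 1 w (of_real \<tau> * v)) \<le> C * \<tau> powr (- Re w)"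
    using gpow_segment_bound[OF compact_segment K] by blast
  have bound: "norm (inc_beta w (of_real \<tau> * x) - inc_beta w (of_real \<tau>)) \<le> C * \<tau> powr (1 - Re w) * norm (x - 1)"
    if \<tau>: "0 < \<tau>" "\<tau> \<le> 1" for \<tau> :: real
  proof -
    have "norm (inc_beta w (of_real \<tau> * x) - inc_beta w (of_real \<tau> * 1)) \<le> (\<tau> * (C * \<tau> powr (- Re w))) * norm (x - 1)"
    proof (rule field_differentiable_bound[where f = "\<lambda>v. inc_beta w (of_real \<tau> * v)" and S = "closed_segment 1 x"
          and f' = "\<lambda>v. - gpow 1 w (of_real \<tau> * v) * of_real \<tau>"])
      fix v assume v: "v \<in> closed_segment 1 x"
      show "((\<lambda>v. inc_beta w (of_real \<tau> * v)) has_field_derivative - gpow 1 w (of_real \<tau> * v) * of_real \<tau>)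
             (at v within closed_segment 1 x)"
        by (rule DERIV_chain2[OF inc_beta_has_field_derivative])
           (use K[OF v] \<tau> w in \<open>auto intro!: derivative_eq_intros\<close>)
      show "norm (- gpow 1 w (of_real \<tau> * v) * of_real \<tau>) \<le> \<tau> * (C * \<tau> powr (- Re w))"
        using C(2)[OF \<tau> v] \<tau> by (simp add: norm_mult mult.commute mult_left_mono)
    qed auto
    also have "\<tau> * (C * \<tau> powr (- Re w)) = C * \<tau> powr (1 - Re w)"
      using \<tau> by (simp add: powr_diff powr_minus field_simps)
    finally show ?thesis by simp
  qed
  have "((\<lambda>\<tau>. C * \<tau> powr (1 - Re w) * norm (x - 1)) \<longlongrightarrow> C * 0 powr (1 - Re w) * norm (x - 1)) (at_right 0)"
    by (intro tendsto_intros tendsto_powr2) (use w in \<open>auto simp: eventually_at_filter\<close>)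
  hence lim0: "((\<lambda>\<tau>. C * \<tau> powr (1 - Re w) * norm (x - 1)) \<longlongrightarrow> 0) (at_right 0)" by simp
  have ev: "\<forall>\<^sub>F \<tau>::real in at_right 0. 0 < \<tau> \<and> \<tau> \<le> 1"
    using eventually_at_right_real[of 0 1] by (rule eventually_mono) auto
  have "((\<lambda>\<tau>. inc_beta w (of_real \<tau> * x) - inc_beta w (of_real \<tau>)) \<longlongrightarrow> 0) (at_right 0)"
    by (rule Lim_null_comparison[OF _ lim0]) (use ev bound in \<open>auto elim!: eventually_mono\<close>)
  from tendsto_add[OF this tendsto_inc_beta[OF w]] show ?thesis by simp
qed

lemma integrable_powr_unit_lborel:
  "a > -1 \<Longrightarrow> integrable unit_lborel (\<lambda>t. t powr a)"
  using beta_integral_unit_lborel(1)[of "a + 1" 1]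
  by (subst Bochner_Integration.integrable_cong[where g = "\<lambda>t. t powr a * (1 - t) powr 0"]) auto

text \<open>The fundamental theorem of calculus along the segment from 0 to x, with the limit just
  found as the value at 0. The result is the primitive normalised at 0 instead of at
  infinity.\<close>

lemma inc_beta_complement:
  assumes w: "Re w < 1" "\<And>r. w \<noteq> - of_nat r" and x: "Re x > 0"
  shows "of_real pi / sin (of_real pi * w) - inc_beta w x = x * (\<integral>t. gpow 1 w (of_real t * x) \<partial>unit_lborel)"
proof -
  define f where "f = (\<lambda>\<tau>. if \<tau> = 0 then of_real pi / sin (of_real pi * w) else inc_beta w (of_real \<tau> * x))"
  obtain C where C: "C \<ge> 0"
    "\<And>\<tau> v. 0 < \<tau> \<Longrightarrow> \<tau> \<le> 1 \<Longrightarrow> v \<in> {x} \<Longrightarrow> norm (gpow 1 w (of_real \<tau> * v)) \<le> C * \<tau> powr (- Re w)"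
    using gpow_segment_bound[of "{x}" w] x by auto
  have int: "integrable unit_lborel (\<lambda>t. gpow 1 w (of_real t * x))"
  proof (rule integrable_unit_lborel_dominated)
    show "integrable unit_lborel (\<lambda>t. C * t powr (- Re w))"
      using w by (intro integrable_mult_right integrable_powr_unit_lborel) auto
    show "continuous_on {0<..<1} (\<lambda>t. gpow 1 w (of_real t * x))"
      by (intro continuous_on_gpow continuous_intros) (use x in auto)
  qed (use C in auto)
  have deriv: "((\<lambda>\<tau>. inc_beta w (of_real \<tau> * x)) has_vector_derivative - (x * gpow 1 w (of_real \<tau> * x))) (at \<tau>)"
    if "\<tau> > 0" for \<tau>
  proof (rule has_vector_derivative_real_field[where f = "\<lambda>u. inc_beta w (u * x)"])
    show "((\<lambda>u. inc_beta w (u * x)) has_field_derivative - (x * gpow 1 w (of_real \<tau> * x))) (at (of_real \<tau>))"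
    proof -
      have "(inc_beta w has_field_derivative - gpow 1 w (of_real \<tau> * x)) (at (of_real \<tau> * x))"
        by (rule inc_beta_has_field_derivative) (use that x w in auto)
      moreover have "((\<lambda>u. u * x) has_field_derivative x) (at (of_real \<tau>))"
        by (auto intro!: derivative_eq_intros)
      ultimately have "((\<lambda>u. inc_beta w (u * x)) has_field_derivative - gpow 1 w (of_real \<tau> * x) * x) (at (of_real \<tau>))"
        by (rule DERIV_chain2)
      thus ?thesis by (simp add: mult.commute)
    qed
  qed
  have "((\<lambda>\<tau>. - (x * gpow 1 w (of_real \<tau> * x))) has_integral (f 1 - f 0)) {0..1}"
  proof (rule fundamental_theorem_of_calculus_interior)
    show "continuous_on {0..1} f"
      unfolding continuous_on_eq_continuous_within
    proof
      fix \<tau> :: real assume \<tau>: "\<tau> \<in> {0..1}"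
      show "continuous (at \<tau> within {0..1}) f"
      proof (cases "\<tau> = 0")
        case True
        have "(f \<longlongrightarrow> f 0) (at_right 0)"
        proof -
          have "\<forall>\<^sub>F \<tau> in at_right 0. inc_beta w (of_real \<tau> * x) = f \<tau>"
            by (auto simp: eventually_at_filter f_def)
          from Lim_transform_eventually[OF tendsto_inc_beta_ray[OF w x] this]
          show ?thesis by (simp add: f_def)
        qed
        hence "(f \<longlongrightarrow> f 0) (at 0 within {0..1})"
          by (simp add: at_within_Icc_at_right)
        thus ?thesis using True by (simp add: continuous_within)
      next
        case False
        hence "\<tau> > 0" using \<tau> by simp
        hence "isCont (\<lambda>\<tau>. inc_beta w (of_real \<tau> * x)) \<tau>"
          using deriv has_vector_derivative_continuous by blast
        moreover have "\<forall>\<^sub>F \<tau> in nhds \<tau>. inc_beta w (of_real \<tau> * x) = f \<tau>"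
        proof -
          have "\<forall>\<^sub>F \<tau> in nhds \<tau>. \<tau> \<in> {0<..}"
            by (rule eventually_nhds_in_open) (use \<open>\<tau> > 0\<close> in auto)
          thus ?thesis by (rule eventually_mono) (auto simp: f_def)
        qed
        ultimately have "isCont f \<tau>" by (metis isCont_cong)
        thus ?thesis by (rule continuous_at_imp_continuous_at_within)
      qed
    qed
    fix \<tau> :: real assume \<tau>: "\<tau> \<in> {0<..<1}"
    show "(f has_vector_derivative - (x * gpow 1 w (of_real \<tau> * x))) (at \<tau>)"
      by (rule has_vector_derivative_transform_within_open[OF deriv, of \<tau> "{0<..}"]) (use \<tau> in \<open>auto simp: f_def\<close>)
  qed auto
  moreover have "((\<lambda>\<tau>. - (x * gpow 1 w (of_real \<tau> * x))) has_integral
      - (x * (\<integral>t. gpow 1 w (of_real t * x) \<partial>unit_lborel))) {0..1}"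
    by (intro has_integral_neg has_integral_mult_right has_integral_unit_lborel int)
  ultimately have "f 1 - f 0 = - (x * (\<integral>t. gpow 1 w (of_real t * x) \<partial>unit_lborel))"
    by (rule has_integral_unique)
  thus ?thesis by (simp add: f_def algebra_simps)
qed

section \<open>Jensen's formula\<close>

lemma norm_powr_le:
  fixes u v :: complex
  assumes "u \<noteq> 0"
  shows "norm (u powr v) \<le> norm u powr Re v * exp (\<bar>Im v\<bar> * pi)"
proof -
  have "Re (v * Ln u) \<le> Re v * ln (norm u) + \<bar>Im v\<bar> * pi"
  proof -
    have "\<bar>Im (Ln u)\<bar> \<le> pi" using mpi_less_Im_Ln[OF assms] Im_Ln_le_pi[OF assms] by linarith
    hence "\<bar>Im v * Im (Ln u)\<bar> \<le> \<bar>Im v\<bar> * pi" by (simp add: abs_mult mult_left_mono)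
    thus ?thesis using assms by simp
  qed
  hence "exp (Re (v * Ln u)) \<le> exp (Re v * ln (norm u) + \<bar>Im v\<bar> * pi)" by simp
  thus ?thesis using assms by (simp add: powr_def norm_exp_eq_Re exp_add)
qed

lemma norm_expm_le:
  assumes "Re w \<ge> 0"
  shows "norm (1 - exp (-w)) \<le> norm (w::complex)"
proof -
  have "norm (exp (-w) - exp (-0)) \<le> 1 * norm (w - 0)"
  proof (rule field_differentiable_bound[where f = "\<lambda>w. exp (-w)" and S = "{w. Re w \<ge> 0}" and f' = "\<lambda>w. - exp (-w)"])
    show "((\<lambda>w. exp (-w)) has_field_derivative - exp (-v)) (at v within {w. Re w \<ge> 0})" for v :: complex
      by (auto intro!: derivative_eq_intros)
  qed (use assms in \<open>auto simp: convex_halfspace_Re_ge norm_exp_eq_Re\<close>)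
  thus ?thesis by (simp add: norm_minus_commute)
qed

lemma norm_expm_arc_le:
  assumes "\<epsilon> \<ge> 0" "Re x > 0"
  shows "norm (expm_arc \<epsilon> x) \<le> norm x"
proof (cases "\<epsilon> = 0")
  case False
  hence "\<epsilon> > 0" using assms by simp
  thus ?thesis using norm_expm_le[of "of_real \<epsilon> * x"] assms
    by (simp add: expm_arc_pos norm_divide norm_mult field_simps)
qed auto

text \<open>With v = \<open>\<epsilon> * Re x\<close> this comes from v e^(-v) <= 1 - e^(-v), that
  is, from 1 + v <= e^v. The decaying factor is later matched exactly by the exponential in
  \<open>gpow\<close>.\<close>

lemma norm_expm_arc_ge:
  assumes "\<epsilon> \<ge> 0" "Re x > 0"
  shows "norm (expm_arc \<epsilon> x) \<ge> Re x * exp (- \<epsilon> * Re x)"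
proof (cases "\<epsilon> = 0")
  case False
  hence e: "\<epsilon> > 0" using assms by simp
  define v where "v = \<epsilon> * Re x"
  have "1 + v \<le> exp v" by (rule exp_ge_add_one_self)
  hence "(1 + v) * exp (-v) \<le> exp v * exp (-v)" by (intro mult_right_mono) auto
  hence "v * exp (-v) \<le> 1 - exp (-v)" by (simp add: algebra_simps exp_minus)
  also have "\<dots> = norm (1::complex) - norm (exp (- of_real \<epsilon> * x))"
    by (simp add: norm_exp_eq_Re v_def)
  also have "\<dots> \<le> norm (1 - exp (- of_real \<epsilon> * x))" by (rule norm_triangle_ineq2)
  finally show ?thesis using e by (simp add: expm_arc_pos norm_divide field_simps v_def)
next
  case True
  thus ?thesis using complex_Re_le_cmod[of x] by simp
qed

text \<open>The bound ln t <= t - 1 at t = (1 + y) / R.\<close>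

lemma powr_le_exp:
  fixes y R :: real
  assumes "y \<ge> 0" "R \<ge> 1"
  shows "(1 + y) powr R \<le> exp (1 + R * ln R) * exp y"
proof -
  have "ln ((1 + y) / R) \<le> (1 + y) / R - 1"
    using assms by (intro ln_le_minus_one) auto
  hence "ln (1 + y) \<le> (1 + y) / R - 1 + ln R"
    using assms by (subst (asm) ln_div) auto
  hence "R * ln (1 + y) \<le> R * ((1 + y) / R - 1 + ln R)"
    using assms by (intro mult_left_mono) auto
  also have "\<dots> = 1 + y - R + R * ln R" using assms by (simp add: field_simps)
  finally have "R * ln (1 + y) \<le> 1 + R * ln R + y" using assms by linarith
  hence "exp (R * ln (1 + y)) \<le> exp (1 + R * ln R + y)" by simp
  thus ?thesis using assms by (simp add: powr_def exp_add)
qed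

text \<open>The exponential factor is at most e^|x| because \<open>\<epsilon>\<close> |w| <= 1. For
  Re w >= 0 the power is at worst singular like t^(-\<open>\<alpha>\<close>); for Re w < 0 it grows
  at most like (1 + |x|)^R, hence like e^|x|.\<close>

lemma gpow_bound:
  assumes \<xi>: "\<xi> > 0" and R: "R \<ge> 1" and \<alpha>: "\<alpha> \<ge> 0"
  obtains C where "C \<ge> 0"
    "\<And>\<epsilon> w x t. 0 \<le> \<epsilon> \<Longrightarrow> \<epsilon> * R \<le> 1 \<Longrightarrow> norm w \<le> R \<Longrightarrow> Re w \<le> \<alpha> \<Longrightarrow> Re x = \<xi> \<Longrightarrow> 0 < t \<Longrightarrow> t \<le> 1
        \<Longrightarrow> norm (gpow \<epsilon> w (of_real t * x)) \<le> C * t powr (-\<alpha>) * exp (2 * norm x)"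
proof -
  \<comment> \<open>On the line Re x = \<open>\<xi>\<close>, with \<open>\<epsilon>\<close> and t at
    most 1, the base of the power has norm at least t \<open>\<delta>\<close>.\<close>
  define \<delta> where "\<delta> = \<xi> * exp (-\<xi>)"
  define C where "C = exp (R * pi) * (\<delta> powr (-\<alpha>) + exp (1 + R * ln R))"
  have \<delta>: "\<delta> > 0" using \<xi> by (simp add: \<delta>_def)
  have \<delta>1: "\<delta> \<le> 1"
  proof -
    have "\<xi> \<le> exp \<xi>" using exp_ge_add_one_self[of \<xi>] by linarith
    thus ?thesis by (simp add: \<delta>_def exp_minus field_simps)
  qed
  have "norm (gpow \<epsilon> w (of_real t * x)) \<le> C * t powr (-\<alpha>) * exp (2 * norm x)"
    if e: "0 \<le> \<epsilon>" "\<epsilon> * R \<le> 1" and w: "norm w \<le> R" "Re w \<le> \<alpha>" and x: "Re x = \<xi>" and t: "0 < t" "t \<le> 1"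
    for \<epsilon> w x t
  proof -
    define m where "m = expm_arc \<epsilon> (of_real t * x)"
    have Retx: "Re (of_real t * x) > 0" using t x \<xi> by simp
    have m0: "m \<noteq> 0" using Re_expm_arc_pos[OF e(1) Retx] by (auto simp: m_def)
    have e1: "\<epsilon> \<le> 1"
    proof -
      have "\<epsilon> * 1 \<le> \<epsilon> * R" using e R by (intro mult_left_mono) auto
      thus ?thesis using e by linarith
    qed
    have "norm (- w * of_real \<epsilon> * (of_real t * x)) = (\<epsilon> * norm w) * (t * norm x)"
      using e t by (simp add: norm_mult mult_ac)
    also have "\<dots> \<le> 1 * (1 * norm x)"
    proof (intro mult_mono)
      show "\<epsilon> * norm w \<le> 1" using mult_left_mono[OF w(1) e(1)] e(2) by linarith
    qed (use t e in auto)
    finally have "Re (- w * of_real \<epsilon> * (of_real t * x)) \<le> norm x"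
      using complex_Re_le_cmod order_trans by (metis mult_1)
    hence 1: "norm (exp (- w * of_real \<epsilon> * (of_real t * x))) \<le> exp (norm x)"
      by (simp add: norm_exp_eq_Re)
    have ml: "t * \<delta> \<le> norm m"
    proof -
      have "\<epsilon> * (t * \<xi>) \<le> 1 * (1 * \<xi>)" using e1 t e \<xi> by (intro mult_mono) auto
      hence "t * \<xi> * exp (-\<xi>) \<le> t * \<xi> * exp (- \<epsilon> * (t * \<xi>))"
        using t \<xi> by (intro mult_left_mono) auto
      also have "\<dots> \<le> norm m" using norm_expm_arc_ge[OF e(1) Retx] x by (simp add: m_def)
      finally show ?thesis by (simp add: \<delta>_def mult_ac)
    qed
    have mu: "norm m \<le> norm x"
    proof -
      have "norm m \<le> t * norm x" using norm_expm_arc_le[OF e(1) Retx] t by (simp add: m_def norm_mult)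
      also have "\<dots> \<le> 1 * norm x" using t by (intro mult_right_mono) auto
      finally show ?thesis by simp
    qed
    have t\<alpha>: "1 \<le> t powr (-\<alpha>)"
      using powr_mono2'[of "-\<alpha>" t 1] t \<alpha> by simp
    have 2: "norm m powr (- Re w) \<le> t powr (-\<alpha>) * ((\<delta> powr (-\<alpha>) + exp (1 + R * ln R)) * exp (norm x))"
    proof (cases "Re w \<ge> 0")
      case True
      have "norm m powr (- Re w) \<le> (t * \<delta>) powr (- Re w)"
        using True ml t \<delta> by (intro powr_mono2') auto
      \<comment> \<open>Since t \<open>\<delta>\<close> <= 1, lowering the exponent increases the
        power.\<close>
      also have "\<dots> \<le> (t * \<delta>) powr (-\<alpha>)"
        using t \<delta> \<delta>1 w(2) mult_le_one[of t \<delta>] by (intro powr_mono') auto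
      also have "\<dots> = t powr (-\<alpha>) * (\<delta> powr (-\<alpha>) * 1)"
        using t \<delta> by (simp add: powr_mult)
      also have "\<dots> \<le> t powr (-\<alpha>) * ((\<delta> powr (-\<alpha>) + exp (1 + R * ln R)) * exp (norm x))"
        by (intro mult_left_mono mult_mono) auto
      finally show ?thesis .
    next
      case False
      have "norm m powr (- Re w) \<le> (1 + norm x) powr (- Re w)"
        using False mu norm_ge_zero[of x] by (intro powr_mono2) auto
      also have "\<dots> \<le> (1 + norm x) powr R"
        using w(1) abs_Re_le_cmod[of w] by (intro powr_mono) auto
      also have "\<dots> \<le> exp (1 + R * ln R) * exp (norm x)"
        using R by (intro powr_le_exp) auto
      also have "\<dots> \<le> 1 * ((\<delta> powr (-\<alpha>) + exp (1 + R * ln R)) * exp (norm x))"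
        by (simp add: mult_right_mono)
      also have "\<dots> \<le> t powr (-\<alpha>) * ((\<delta> powr (-\<alpha>) + exp (1 + R * ln R)) * exp (norm x))"
        by (intro mult_right_mono t\<alpha>) (auto intro!: mult_nonneg_nonneg add_nonneg_nonneg)
      finally show ?thesis .
    qed
    have 3: "norm (m powr (-w)) \<le> norm m powr (- Re w) * exp (R * pi)"
    proof -
      have "norm (m powr (-w)) \<le> norm m powr (- Re w) * exp (\<bar>Im w\<bar> * pi)"
        using norm_powr_le[OF m0, of "-w"] by simp
      also have "\<dots> \<le> norm m powr (- Re w) * exp (R * pi)"
        using w(1) abs_Im_le_cmod[of w] by (intro mult_left_mono) auto
      finally show ?thesis .
    qed
    have "norm (gpow \<epsilon> w (of_real t * x)) \<le> exp (norm x) * (norm m powr (- Re w) * exp (R * pi))"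
      unfolding gpow_def norm_mult m_def[symmetric] by (intro mult_mono 1 3) auto
    also have "\<dots> \<le> exp (norm x) * (t powr (-\<alpha>) * ((\<delta> powr (-\<alpha>) + exp (1 + R * ln R)) * exp (norm x)) * exp (R * pi))"
      by (intro mult_left_mono mult_right_mono 2) auto
    also have "\<dots> = C * t powr (-\<alpha>) * (exp (norm x) * exp (norm x))"
      by (simp add: C_def mult_ac)
    also have "exp (norm x) * exp (norm x) = exp (2 * norm x)"
      by (simp flip: exp_add)
    finally show ?thesis .
  qed
  thus ?thesis using that[of C] by (simp add: C_def)
qed

text \<open>The substitution \<open>p = 1 / (1 + e\<^bsup>-2\<pi>y\<^esup>)\<close> turns the kernel \<open>\<pi> / (2 cosh\<^sup>2 \<pi>y) dy\<close> of Jensen's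
  formula into Lebesgue measure on the unit interval; \<open>logit p / (2\<pi>)\<close> is \<open>y\<close>.\<close>

definition jline :: "complex \<Rightarrow> real \<Rightarrow> complex" where
  "jline z p = z + 1 / 2 + \<i> * of_real (logit p / (2 * pi))"

lemma Re_jline [simp]: "Re (jline z p) = Re z + 1 / 2"
  by (simp add: jline_def)

lemma continuous_on_jline [continuous_intros]:
  "continuous_on A f \<Longrightarrow> (\<And>x. x \<in> A \<Longrightarrow> 0 < f x \<and> f x < 1) \<Longrightarrow> continuous_on A (\<lambda>x. jline z (f x))"
  unfolding jline_def by (intro continuous_intros) auto

text \<open>The imaginary part grows like |logit p| / (2 pi), and 3 / (2 pi) <= 1/2 because pi > 3.
  The 3 leaves room for the e^(2|x|) of \<open>gpow_bound\<close> and one linear factor |x|.\<close>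

lemma exp_norm_jline_le:
  assumes p: "0 < p" "p < 1"
  shows "exp (3 * norm (jline z p)) \<le> exp (3 * (norm z + 1 / 2)) * (p powr (-1/2) * (1 - p) powr (-1/2))"
proof -
  have "norm (jline z p) \<le> norm z + norm (1 / 2 :: complex) + norm (\<i> * of_real (logit p / (2 * pi)))"
    unfolding jline_def by (intro norm_triangle_le add_mono norm_triangle_ineq order_refl)
  also have "\<dots> = norm z + 1 / 2 + \<bar>logit p\<bar> / (2 * pi)"
    by (simp add: norm_mult norm_divide)
  finally have "3 * norm (jline z p) \<le> 3 * (norm z + 1 / 2) + 3 / (2 * pi) * \<bar>logit p\<bar>"
    by simp
  hence "exp (3 * norm (jline z p)) \<le> exp (3 * (norm z + 1 / 2)) * exp (3 / (2 * pi) * \<bar>logit p\<bar>)"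
    by (simp flip: exp_add)
  also have "exp (3 / (2 * pi) * \<bar>logit p\<bar>) \<le> p powr (-(1/2)) * (1 - p) powr (-(1/2))"
  proof -
    have pi: "3 / (2 * pi) \<le> 1 / 2" using pi_gt3 by (simp add: field_simps)
    define c where "c = (if logit p \<ge> 0 then 3 / (2 * pi) else - (3 / (2 * pi)))"
    have "exp (c * logit p) \<le> p powr (-(1/2)) * (1 - p) powr (-(1/2))"
      by (rule exp_abs_logit_le[OF p]) (use pi in \<open>auto simp: c_def\<close>)
    thus ?thesis by (simp add: c_def split: if_splits)
  qed
  finally show ?thesis by simp
qed

section \<open>Joint continuity of the deformed Jensen integral\<close>

lemma integrable_jline_majorant:
  "integrable unit_lborel (\<lambda>p. exp (3 * (norm z + 1 / 2)) * (p powr (-1/2) * (1 - p) powr (-1/2)))"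
  using beta_integral_unit_lborel(1)[of "1/2" "1/2"] by simp

text \<open>For \<open>\<epsilon> > 0\<close> and noninteger s with Re s < 2 the outer integrand is
  the rescaled difference of P_s and pi / sin (pi s), expressed through the parameter s - 1. In this
  form nothing is singular at s = 0, -1, -2, ..., and \<open>\<epsilon> = 0\<close> gives Jensen's
  integral.\<close>

definition jensen :: "complex \<Rightarrow> real \<Rightarrow> complex \<Rightarrow> complex" where
  "jensen z \<epsilon> s = gpow \<epsilon> s z + (\<integral>p. gpow \<epsilon> (s - 1) (jline z p) / (s - 1) +
     of_real \<epsilon> * jline z p * (\<integral>t. gpow \<epsilon> (s - 1) (of_real t * jline z p) \<partial>unit_lborel) \<partial>unit_lborel)"

text \<open>Dominated convergence twice, in t and in p. The bound R serves
  \<open>gpow_bound\<close>, \<open>\<alpha> < 1\<close> makes t^(-\<open>\<alpha>\<close>)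
  integrable, and r keeps s away from the pole at 1.\<close>

lemma continuous_on_jensen:
  assumes z: "Re z > 0" and R: "R \<ge> 1" and \<alpha>: "0 \<le> \<alpha>" "\<alpha> < 1" and r: "r > 0"
  shows "continuous_on ({0..1/R} \<times> {s. norm (s - 1) \<le> R \<and> Re (s - 1) \<le> \<alpha> \<and> norm (s - 1) \<ge> r}) (\<lambda>(\<epsilon>, s). jensen z \<epsilon> s)"
proof -
  define U where "U = {0..1/R} \<times> {s. norm (s - 1) \<le> R \<and> Re (s - 1) \<le> \<alpha> \<and> norm (s - 1) \<ge> r}"
  have U: "0 \<le> fst u" "fst u * R \<le> 1" "fst u \<le> 1" "norm (snd u - 1) \<le> R" "Re (snd u - 1) \<le> \<alpha>" "r \<le> norm (snd u - 1)"
    if "u \<in> U" for u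
  proof -
    show "fst u * R \<le> 1" using that R by (auto simp: U_def field_simps)
    have "fst u \<le> 1 / R" using that by (auto simp: U_def)
    also have "\<dots> \<le> 1" using R by simp
    finally show "fst u \<le> 1" .
  qed (use that in \<open>auto simp: U_def\<close>)
  define \<xi> where "\<xi> = Re z + 1 / 2"
  have \<xi>: "\<xi> > 0" using z by (simp add: \<xi>_def)
  obtain C where C: "C \<ge> 0"
    "\<And>\<epsilon> w x t. 0 \<le> \<epsilon> \<Longrightarrow> \<epsilon> * R \<le> 1 \<Longrightarrow> norm w \<le> R \<Longrightarrow> Re w \<le> \<alpha> \<Longrightarrow> Re x = \<xi> \<Longrightarrow> 0 < t \<Longrightarrow> t \<le> 1
        \<Longrightarrow> norm (gpow \<epsilon> w (of_real t * x)) \<le> C * t powr (-\<alpha>) * exp (2 * norm x)"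
    using gpow_bound[OF \<xi> R \<alpha>(1)] by blast
  have int_t: "integrable unit_lborel (\<lambda>t. C * t powr (-\<alpha>))"
    using \<alpha> by (intro integrable_mult_right integrable_powr_unit_lborel) auto
  define D where "D = (\<integral>t. C * t powr (-\<alpha>) \<partial>unit_lborel)"
  define N where "N = (\<lambda>(u::real \<times> complex) p. \<integral>t. gpow (fst u) (snd u - 1) (of_real t * jline z p) \<partial>unit_lborel)"
  have N_bound: "norm (N u p) \<le> D * exp (2 * norm (jline z p))" if u: "u \<in> U" and p: "0 < p" "p < 1" for u p
  proof -
    have "norm (N u p) \<le> (\<integral>t. C * t powr (-\<alpha>) * exp (2 * norm (jline z p)) \<partial>unit_lborel)"
      unfolding N_def
    proof (rule Bochner_Integration.integral_norm_bound_integral)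
      show int: "integrable unit_lborel (\<lambda>t. C * t powr (-\<alpha>) * exp (2 * norm (jline z p)))"
        by (intro integrable_mult_left int_t)
      show "integrable unit_lborel (\<lambda>t. gpow (fst u) (snd u - 1) (of_real t * jline z p))"
      proof (rule integrable_unit_lborel_dominated[OF _ _ int])
        show "continuous_on {0<..<1} (\<lambda>t. gpow (fst u) (snd u - 1) (of_real t * jline z p))"
          by (intro continuous_on_gpow continuous_intros) (use U[OF u] z in auto)
      qed (use C(2) U[OF u] in \<open>auto simp: \<xi>_def\<close>)
    qed (use C(2) U[OF u] in \<open>auto simp: \<xi>_def\<close>)
    thus ?thesis by (simp add: D_def)
  qed
  \<comment> \<open>Here p is a parameter, and the bound for the integrand contains exp (2 |jline z
    p|). Dividing by this factor makes the majorant independent of p; it is restored outside the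
    integral.\<close>
  have N_cont: "continuous_on (U \<times> {0<..<1::real}) (\<lambda>(u, p). N u p)"
  proof -
    have "continuous_on (U \<times> {0<..<1::real})
       (\<lambda>v :: (real \<times> complex) \<times> real. \<integral>t. exp (- 2 * norm (jline z (snd v))) *\<^sub>R gpow (fst (fst v)) (snd (fst v) - 1) (of_real t * jline z (snd v)) \<partial>unit_lborel)"
    proof (rule continuous_on_integral_dominated[OF _ _ int_t])
      show "continuous_on ((U \<times> {0<..<1::real}) \<times> {0<..<1}) (\<lambda>(v :: (real \<times> complex) \<times> real, t). exp (- 2 * norm (jline z (snd v))) *\<^sub>R 
          gpow (fst (fst v)) (snd (fst v) - 1) (of_real t * jline z (snd v)))"
        unfolding case_prod_unfold
        by (intro continuous_intros continuous_on_gpow) (use U z in auto)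
      fix v t assume v: "v \<in> U \<times> {0<..<1::real}" and t: "0 < (t::real)" "t < 1"
      have "norm (gpow (fst (fst v)) (snd (fst v) - 1) (of_real t * jline z (snd v))) \<le>
            C * t powr (-\<alpha>) * exp (2 * norm (jline z (snd v)))"
        using v t by (intro C(2) U) (auto simp: \<xi>_def)
      thus "norm (exp (- 2 * norm (jline z (snd v))) *\<^sub>R gpow (fst (fst v)) (snd (fst v) - 1) (of_real t * jline z (snd v)))
            \<le> C * t powr (-\<alpha>)"
        by (simp add: exp_minus field_simps)
    qed
    hence "continuous_on (U \<times> {0<..<1::real}) (\<lambda>v :: (real \<times> complex) \<times> real. exp (2 * norm (jline z (snd v))) *\<^sub>R
        (\<integral>t. exp (- 2 * norm (jline z (snd v))) *\<^sub>R gpow (fst (fst v)) (snd (fst v) - 1) (of_real t * jline z (snd v)) \<partial>unit_lborel))"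
      by (intro continuous_intros) auto
    thus ?thesis
      by (simp add: N_def case_prod_unfold flip: exp_add)
  qed
  have "continuous_on U (\<lambda>u. \<integral>p. gpow (fst u) (snd u - 1) (jline z p) / (snd u - 1) +
     of_real (fst u) * jline z p * N u p \<partial>unit_lborel)"
  proof (rule continuous_on_integral_dominated)
    show "integrable unit_lborel (\<lambda>p. (C / r + D) * (exp (3 * (norm z + 1 / 2)) * (p powr (-1/2) * (1 - p) powr (-1/2))))"
      by (intro integrable_mult_right integrable_jline_majorant)
    have nz: "snd u - 1 \<noteq> 0" if "u \<in> U" for u using U(6)[OF that] r by auto
    show "continuous_on (U \<times> {0<..<1::real}) (\<lambda>(u, p). gpow (fst u) (snd u - 1) (jline z p) / (snd u - 1) +
             of_real (fst u) * jline z p * N u p)"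
      using N_cont unfolding case_prod_unfold
      by (intro continuous_intros continuous_on_gpow) (use U z nz in auto)
    fix u p assume u: "u \<in> U" and p: "0 < (p::real)" "p < 1"
    define y where "y = norm (jline z p)"
    have D0: "D \<ge> 0" unfolding D_def using C(1) by (intro Bochner_Integration.integral_nonneg) auto
    have "norm (gpow (fst u) (snd u - 1) (jline z p) / (snd u - 1)) \<le> C * exp (2 * y) / r"
      unfolding norm_divide using C(2)[of "fst u" "snd u - 1" "jline z p" 1] U[OF u] r C(1)
      by (intro frac_le) (auto simp: \<xi>_def y_def)
    moreover have "norm (of_real (fst u) * jline z p * N u p) \<le> 1 * y * (D * exp (2 * y))"
      unfolding norm_mult y_def using U[OF u] D0
      by (intro mult_mono N_bound u p) auto
    ultimately have "norm (gpow (fst u) (snd u - 1) (jline z p) / (snd u - 1) + of_real (fst u) * jline z p * N u p)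
      \<le> C * exp (2 * y) / r + 1 * y * (D * exp (2 * y))"
      by (rule norm_triangle_mono)
    also have "\<dots> = (C / r * 1 + D * y) * exp (2 * y)" by (simp add: field_simps)
    also have "\<dots> \<le> (C / r * exp y + D * exp y) * exp (2 * y)"
    proof -
      have "y \<ge> 0" by (simp add: y_def)
      hence "1 \<le> exp y" "y \<le> exp y" using exp_ge_add_one_self[of y] by linarith+
      thus ?thesis using C(1) r D0 by (intro mult_right_mono add_mono mult_left_mono) auto
    qed
    also have "\<dots> = (C / r + D) * exp (3 * y)"
      by (simp add: algebra_simps flip: exp_add)
    also have "\<dots> \<le> (C / r + D) * (exp (3 * (norm z + 1 / 2)) * (p powr (-1/2) * (1 - p) powr (-1/2)))"
      unfolding y_def using C(1) r D0 by (intro mult_left_mono exp_norm_jline_le p) auto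
    finally show "norm (gpow (fst u) (snd u - 1) (jline z p) / (snd u - 1) + of_real (fst u) * jline z p * N u p)
      \<le> (C / r + D) * (exp (3 * (norm z + 1 / 2)) * (p powr (-1/2) * (1 - p) powr (-1/2)))" .
  qed
  moreover have "continuous_on U (\<lambda>u. gpow (fst u) (snd u) z)"
    by (intro continuous_on_gpow continuous_intros) (use U z in auto)
  ultimately have "continuous_on U (\<lambda>u. jensen z (fst u) (snd u))"
    unfolding jensen_def N_def by (intro continuous_intros)
  thus ?thesis by (simp add: U_def case_prod_unfold)
qed

lemma jensen_continuity:
  assumes z: "Re z > 0" and s: "Re s < 2" "s \<noteq> 1"
  obtains \<epsilon>0 where "\<epsilon>0 > 0" "continuous_on {0..\<epsilon>0} (\<lambda>\<epsilon>. jensen z \<epsilon> s)"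
    "\<And>\<epsilon>. 0 \<le> \<epsilon> \<Longrightarrow> \<epsilon> \<le> \<epsilon>0 \<Longrightarrow> isCont (jensen z \<epsilon>) s"
proof -
  \<comment> \<open>The constants put a neighbourhood of s into the region of
    \<open>continuous_on_jensen\<close>. As Re s < 2, both Re s - 1 < Re s / 2 and Re s / 2 < 1,
    which leaves room for \<open>\<alpha>\<close>.\<close>
  define R where "R = norm (s - 1) + 1"
  define \<alpha> where "\<alpha> = max 0 (Re s / 2)"
  define r where "r = norm (s - 1) / 2"
  define V where "V = {s. norm (s - 1) \<le> R \<and> Re (s - 1) \<le> \<alpha> \<and> norm (s - 1) \<ge> r}"
  have R: "R \<ge> 1" by (simp add: R_def)
  have \<alpha>: "0 \<le> \<alpha>" "\<alpha> < 1" using s by (auto simp: \<alpha>_def)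
  have r: "r > 0" using s by (simp add: r_def)
  have cont: "continuous_on ({0..1/R} \<times> V) (\<lambda>(\<epsilon>, s). jensen z \<epsilon> s)"
    unfolding V_def by (rule continuous_on_jensen[OF z R \<alpha> r])
  define d where "d = Min {1, 1 - Re s / 2, r}"
  have d: "d > 0" "d \<le> 1" "d \<le> 1 - Re s / 2" "d \<le> r" using s r by (auto simp: d_def)
  have V: "ball s d \<subseteq> V"
  proof
    fix v assume "v \<in> ball s d"
    hence *: "norm (v - s) < d" by (simp add: dist_norm norm_minus_commute)
    have "norm (v - 1) \<le> norm (v - s) + norm (s - 1)" "norm (s - 1) \<le> norm (v - 1) + norm (v - s)"
      using norm_triangle_ineq[of "v - s" "s - 1"] norm_triangle_ineq[of "v - 1" "s - v"]
      by (simp_all add: norm_minus_commute)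
    moreover have "Re v - Re s \<le> norm (v - s)" using complex_Re_le_cmod[of "v - s"] by simp
    ultimately show "v \<in> V" using * d by (auto simp: V_def R_def r_def \<alpha>_def)
  qed
  show ?thesis
  proof (rule that[of "1/R"])
    have "s \<in> V" using V d by auto
    hence "continuous_on {0..1/R} (\<lambda>\<epsilon>. (\<lambda>(\<epsilon>, s). jensen z \<epsilon> s) (\<epsilon>, s))"
      by (intro continuous_on_compose2[OF cont] continuous_intros) auto
    thus "continuous_on {0..1/R} (\<lambda>\<epsilon>. jensen z \<epsilon> s)" by simp
    show "isCont (jensen z \<epsilon>) s" if "0 \<le> \<epsilon>" "\<epsilon> \<le> 1 / R" for \<epsilon>
    proof -
      have "continuous_on (ball s d) (\<lambda>s. (\<lambda>(\<epsilon>, s). jensen z \<epsilon> s) (\<epsilon>, s))"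
        using that V by (intro continuous_on_compose2[OF cont] continuous_intros) auto
      hence "continuous_on (ball s d) (jensen z \<epsilon>)" by simp
      thus ?thesis using d by (simp add: continuous_on_eq_continuous_at)
    qed
  qed (use R in auto)
qed

section \<open>Lattice sums as averages over the vertical line\<close>

lemma finite_measure_unit_lborel: "finite_measure unit_lborel"
  by (rule finite_measureI) (simp add: emeasure_restrict_space)

lemma measure_unit_lborel: "measure unit_lborel {0<..<1} = 1"
  by (simp add: measure_restrict_space)

text \<open>With c = -i a / (2 pi) the integrand is e^(-a (z + 1/2)) (p / (1-p))^c, so the integral
  is e^(-a z) e^(-a/2) (a/2) / sinh (a/2). The bound on Im a says |Re c| < 1.\<close>

lemma integral_exp_jline:
  assumes a: "a \<noteq> 0" "\<bar>Im a\<bar> < 2 * pi"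
  shows "exp (- a * z) + (\<integral>p. exp (- a * jline z p) \<partial>unit_lborel) / a = exp (- a * z) / (1 - exp (- a))"
proof -
  define c where "c = - \<i> * a / (2 * of_real pi)"
  have c: "\<bar>Re c\<bar> < 1" using a pi_gt_zero by (simp add: c_def abs_mult)
  define I where "I = (\<integral>p. exp (c * of_real (logit p)) \<partial>unit_lborel)"
  have pc: "of_real pi * c = - \<i> * (a / 2)" by (simp add: c_def)
  have sinI: "sin (of_real pi * c) * I = of_real pi * c"
    unfolding I_def by (rule integral_exp_logit[OF c])
  have sin: "sin (of_real pi * c) = - \<i> * (exp (a / 2) - exp (- (a / 2))) / 2"
  proof -
    have "sin (of_real pi * c) = (exp (a / 2) - exp (- (a / 2))) / (2 * \<i>)"
      unfolding pc sin_exp_eq by simp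
    also have "\<dots> = (exp (a / 2) - exp (- (a / 2))) / \<i> / 2" by simp
    finally show ?thesis by simp
  qed
  have I: "(exp (a / 2) - exp (- (a / 2))) * I = a"
  proof -
    have "- \<i> * (exp (a / 2) - exp (- (a / 2))) / 2 * I = - \<i> * (a / 2)"
      using sinI[unfolded sin] unfolding pc .
    hence "- (\<i> / 2) * ((exp (a / 2) - exp (- (a / 2))) * I) = - (\<i> / 2) * a" by simp
    thus ?thesis by (subst (asm) mult_cancel_left) auto
  qed
  \<comment> \<open>The product with \<open>I\<close> is a, which is not 0.\<close>
  hence ne: "exp (a / 2) - exp (- (a / 2)) \<noteq> 0" using a by auto
  have e2: "exp (a / 2) * exp (- (a / 2)) = 1" "exp (- a) = exp (- (a / 2)) * exp (- (a / 2))"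
    by (simp_all flip: exp_add)
  have "1 - exp (- a) = exp (- (a / 2)) * (exp (a / 2) - exp (- (a / 2)))"
    using e2 by (simp add: algebra_simps)
  hence ne': "1 - exp (- a) \<noteq> 0" using ne by simp
  have "(\<integral>p. exp (- a * jline z p) \<partial>unit_lborel) = (\<integral>p. exp (- a * (z + 1 / 2)) * exp (c * of_real (logit p)) \<partial>unit_lborel)"
    by (rule Bochner_Integration.integral_cong)
       (auto simp: jline_def c_def algebra_simps simp flip: exp_add)
  also have "\<dots> = exp (- a * z) * exp (- (a / 2)) * I"
  proof -
    have "exp (- a * (z + 1 / 2)) = exp (- a * z) * exp (- (a / 2))"
      by (simp add: algebra_simps flip: exp_add)
    thus ?thesis unfolding I_def by simp
  qed
  finally have J: "(\<integral>p. exp (- a * jline z p) \<partial>unit_lborel) = exp (- a * z) * exp (- (a / 2)) * I" .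
  have "(1 - exp (- a)) * I = exp (- (a / 2)) * a"
    unfolding \<open>1 - exp (- a) = _\<close> using I by (simp add: mult.assoc)
  hence "exp (- (a / 2)) * I / a = exp (- a) / (1 - exp (- a))"
  proof (subst frac_eq_eq[OF a(1) ne'])
    have "exp (- (a / 2)) * I * (1 - exp (- a)) = exp (- (a / 2)) * ((1 - exp (- a)) * I)"
      by (simp only: mult_ac)
    also have "\<dots> = exp (- a) * a"
      unfolding \<open>(1 - exp (- a)) * I = _\<close> by (simp only: e2(2) mult_ac)
    finally show "exp (- (a / 2)) * I * (1 - exp (- a)) = exp (- a) * a" .
  qed
  hence "exp (- a * z) + exp (- a * z) * (exp (- (a / 2)) * I / a) = exp (- a * z) + exp (- a * z) * (exp (- a) / (1 - exp (- a)))"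
    by simp
  also have "\<dots> = exp (- a * z) / (1 - exp (- a))"
    using ne' by (simp add: field_simps)
  finally show "exp (- a * z) + (\<integral>p. exp (- a * jline z p) \<partial>unit_lborel) / a = exp (- a * z) / (1 - exp (- a))"
    unfolding J by (simp add: mult.assoc)
qed

text \<open>\<open>integral_exp_jline\<close> for every r, with sum and integral exchanged. In 1 / a
  r the factor 1 / (w + r) produces the coefficients of \<open>ibeta\<close>;
  \<open>\<epsilon>\<close> |w| <= 1 keeps |Im (a r)| below 2 pi.\<close>

lemma jensen_series:
  assumes z: "Re z > 0" and \<epsilon>: "\<epsilon> > 0" "\<epsilon> * norm w \<le> 1" and w: "\<And>r. w \<noteq> - of_nat r"
  defines "a \<equiv> \<lambda>r. of_real \<epsilon> * (w + of_nat r)"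
  shows "integrable unit_lborel (\<lambda>p. inc_beta w (of_real \<epsilon> * jline z p))"
    and "(\<lambda>r. neg_binom w r * exp (- a r * z) / (1 - exp (- a r))) sums
       (gpow 1 w (of_real \<epsilon> * z) + (\<integral>p. inc_beta w (of_real \<epsilon> * jline z p) \<partial>unit_lborel) / of_real \<epsilon>)"
proof -
  define c where "c = (\<lambda>r. neg_binom w r / (w + of_nat r))"
  define f where "f = (\<lambda>r p. c r * exp (- a r * jline z p))"
  \<comment> \<open>The norm of exp (-\<open>\<epsilon>\<close> jline z p), the same for all p since
    the line is vertical.\<close>
  define \<rho> where "\<rho> = exp (- \<epsilon> * (Re z + 1 / 2))"
  have \<rho>: "0 < \<rho>" "\<rho> < 1" using z \<epsilon> by (auto simp: \<rho>_def mult_pos_pos)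
  define M where "M = (\<lambda>p. exp (3 * (norm z + 1 / 2)) * (p powr (-1/2) * (1 - p) powr (-1/2)))"
  have M: "integrable unit_lborel M" unfolding M_def by (rule integrable_jline_majorant)
  have f_eq: "f r p = exp (- w * (of_real \<epsilon> * jline z p)) * (c r * exp (- (of_real \<epsilon> * jline z p)) ^ r)" for r p
    by (simp add: f_def a_def algebra_simps flip: exp_of_nat_mult exp_add)
  have bound: "norm (f r p) \<le> norm (c r) * \<rho> ^ r * M p" if p: "0 < p" "p < 1" for r p
  proof -
    have "norm (- w * (of_real \<epsilon> * jline z p)) = (\<epsilon> * norm w) * norm (jline z p)"
      using \<epsilon> by (simp add: norm_mult mult_ac)
    also have "\<dots> \<le> 1 * norm (jline z p)" using \<epsilon> by (intro mult_right_mono) auto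
    also have "\<dots> \<le> 3 * norm (jline z p)" by simp
    finally have "Re (- w * (of_real \<epsilon> * jline z p)) \<le> 3 * norm (jline z p)"
      using complex_Re_le_cmod order_trans by blast
    hence "norm (exp (- w * (of_real \<epsilon> * jline z p))) \<le> M p"
      using exp_norm_jline_le[OF p, of z] unfolding M_def norm_exp_eq_Re
      by (meson exp_le_cancel_iff order_trans)
    moreover have "norm (c r * exp (- (of_real \<epsilon> * jline z p)) ^ r) = norm (c r) * \<rho> ^ r"
      by (simp add: norm_mult norm_power norm_exp_eq_Re \<rho>_def)
    ultimately have "norm (exp (- w * (of_real \<epsilon> * jline z p))) * norm (c r * exp (- (of_real \<epsilon> * jline z p)) ^ r)
        \<le> M p * (norm (c r) * \<rho> ^ r)"
      using \<rho> by (simp add: mult_right_mono)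
    thus ?thesis unfolding f_eq by (simp add: norm_mult mult_ac)
  qed
  have sum_c: "summable (\<lambda>r. norm (c r) * \<rho> ^ r)"
    using summable_norm_ibeta[of "of_real \<rho>" w] \<rho> by (simp add: c_def norm_mult norm_power norm_divide)
  have int_f: "integrable unit_lborel (f r)" for r
  proof (rule integrable_unit_lborel_dominated[OF _ bound])
    show "continuous_on {0<..<1} (f r)" unfolding f_def by (intro continuous_intros) auto
  qed (use M in \<open>auto intro!: integrable_mult_right\<close>)
  have sum_norm: "AE p in unit_lborel. summable (\<lambda>r. norm (f r p))"
  proof (rule AE_I2)
    fix p assume "p \<in> space unit_lborel"
    hence p: "0 < p" "p < 1" by auto
    show "summable (\<lambda>r. norm (f r p))"
      by (rule summable_comparison_test'[where N = 0 and g = "\<lambda>r. norm (c r) * \<rho> ^ r * M p"])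
         (use bound[OF p] in \<open>auto intro!: summable_mult2 sum_c\<close>)
  qed
  have sum_int: "summable (\<lambda>r. \<integral>p. norm (f r p) \<partial>unit_lborel)"
  proof (rule summable_comparison_test'[where N = 0 and g = "\<lambda>r. norm (c r) * \<rho> ^ r * (\<integral>p. M p \<partial>unit_lborel)"])
    fix r
    have "(\<integral>p. norm (f r p) \<partial>unit_lborel) \<le> (\<integral>p. norm (c r) * \<rho> ^ r * M p \<partial>unit_lborel)"
      by (rule Bochner_Integration.integral_mono) (use int_f M bound in auto)
    thus "norm (\<integral>p. norm (f r p) \<partial>unit_lborel) \<le> norm (c r) * \<rho> ^ r * (\<integral>p. M p \<partial>unit_lborel)"
      by simp
  qed (intro summable_mult2 sum_c)
  have suminf_f: "(\<Sum>r. f r p) = inc_beta w (of_real \<epsilon> * jline z p)" for p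
  proof -
    have "norm (exp (- (of_real \<epsilon> * jline z p))) = \<rho>" by (simp add: norm_exp_eq_Re \<rho>_def)
    hence "summable (\<lambda>r. c r * exp (- (of_real \<epsilon> * jline z p)) ^ r)"
      using summable_ibeta[of "exp (- (of_real \<epsilon> * jline z p))" w] \<rho> by (simp add: c_def)
    from suminf_mult[OF this] show ?thesis
      unfolding f_eq by (simp add: inc_beta_def ibeta_def c_def)
  qed
  show "integrable unit_lborel (\<lambda>p. inc_beta w (of_real \<epsilon> * jline z p))"
    using integrable_suminf[OF int_f sum_norm sum_int] by (simp add: suminf_f)
  have S: "(\<lambda>r. \<integral>p. f r p \<partial>unit_lborel) sums (\<integral>p. inc_beta w (of_real \<epsilon> * jline z p) \<partial>unit_lborel)"
    using sums_integral[OF int_f sum_norm sum_int] by (simp add: suminf_f)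
  have "norm (exp (- (of_real \<epsilon> * z))) < 1" using z \<epsilon> by (simp add: norm_exp_eq_Re)
  from sums_mult[OF neg_binom_sums[OF this], of "exp (- w * (of_real \<epsilon> * z))" w]
  have G: "(\<lambda>r. neg_binom w r * exp (- a r * z)) sums gpow 1 w (of_real \<epsilon> * z)"
    by (simp add: gpow_1 a_def algebra_simps flip: exp_of_nat_mult exp_add)
  have "(\<lambda>r. neg_binom w r * exp (- a r * z) + (\<integral>p. f r p \<partial>unit_lborel) / of_real \<epsilon>) sums
       (gpow 1 w (of_real \<epsilon> * z) + (\<integral>p. inc_beta w (of_real \<epsilon> * jline z p) \<partial>unit_lborel) / of_real \<epsilon>)"
    by (intro sums_add G sums_divide S)
  also have "(\<lambda>r. neg_binom w r * exp (- a r * z) + (\<integral>p. f r p \<partial>unit_lborel) / of_real \<epsilon>) =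
      (\<lambda>r. neg_binom w r * exp (- a r * z) / (1 - exp (- a r)))"
  proof
    fix r
    have nz: "w + of_nat r \<noteq> 0" using w[of r] by (simp add: eq_neg_iff_add_eq_0)
    have a0: "a r \<noteq> 0" using nz \<epsilon> by (simp add: a_def)
    have "\<bar>Im (a r)\<bar> = \<epsilon> * \<bar>Im w\<bar>" using \<epsilon> by (simp add: a_def abs_mult)
    also have "\<dots> \<le> \<epsilon> * norm w" using \<epsilon> abs_Im_le_cmod[of w] by (intro mult_left_mono) auto
    finally have "\<bar>Im (a r)\<bar> < 2 * pi" using \<epsilon> pi_gt3 by linarith
    note e = integral_exp_jline[OF a0 this, of z, symmetric]
    have "neg_binom w r * exp (- a r * z) / (1 - exp (- a r)) =
      neg_binom w r * (exp (- a r * z) + (\<integral>p. exp (- a r * jline z p) \<partial>unit_lborel) / a r)"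
      by (simp only: times_divide_eq_right[symmetric] e)
    also have "\<dots> = neg_binom w r * exp (- a r * z) + c r * (\<integral>p. exp (- a r * jline z p) \<partial>unit_lborel) / of_real \<epsilon>"
    proof -
      have ar: "a r = (w + of_nat r) * of_real \<epsilon>" by (simp add: a_def mult.commute)
      show ?thesis by (simp add: c_def ar distrib_left[of "neg_binom w r"])
    qed
    also have "c r * (\<integral>p. exp (- a r * jline z p) \<partial>unit_lborel) = (\<integral>p. f r p \<partial>unit_lborel)"
      by (simp add: f_def)
    finally show "neg_binom w r * exp (- a r * z) + (\<integral>p. f r p \<partial>unit_lborel) / of_real \<epsilon> =
        neg_binom w r * exp (- a r * z) / (1 - exp (- a r))" ..
  qed
  finally show "(\<lambda>r. neg_binom w r * exp (- a r * z) / (1 - exp (- a r))) sums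
       (gpow 1 w (of_real \<epsilon> * z) + (\<integral>p. inc_beta w (of_real \<epsilon> * jline z p) \<partial>unit_lborel) / of_real \<epsilon>)" .
qed

definition lattice_term :: "complex \<Rightarrow> real \<Rightarrow> nat \<Rightarrow> complex \<Rightarrow> complex" where
  "lattice_term z \<epsilon> r w = neg_binom w r * exp (- (of_real \<epsilon> * (w + of_nat r)) * z) / (1 - exp (- (of_real \<epsilon> * (w + of_nat r))))"

text \<open>For Re w > 0 this is the sum of \<open>gpow 1 w\<close> over the points
  \<open>\<epsilon>\<close> (k + z), by \<open>gpow_sums_lattice_sum\<close>; the rearranged form
  continues it to the left.\<close>

definition lattice_sum :: "complex \<Rightarrow> real \<Rightarrow> complex \<Rightarrow> complex" where
  "lattice_sum z \<epsilon> w = (\<Sum>r. lattice_term z \<epsilon> r w)"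

text \<open>The total mass is 1, so the constant pi / sin (pi s) moves under the average. Passing to
  s - 1 by \<open>inc_beta_recurrence\<close> brings the real part below 1, where
  \<open>inc_beta_complement\<close> applies.\<close>

lemma lattice_sum_eq_jensen:
  assumes z: "Re z > 0" and \<epsilon>: "\<epsilon> > 0" "\<epsilon> * norm s \<le> 1" and s: "Re s < 2" "s \<notin> \<int>"
  shows "of_real \<epsilon> powr s * (lattice_sum z \<epsilon> s - of_real pi / (of_real \<epsilon> * sin (of_real pi * s))) = jensen z \<epsilon> s"
proof -
  have s0: "s \<noteq> - of_nat r" for r using s by auto
  have s1: "s - 1 \<noteq> - of_nat r" for r
  proof
    assume "s - 1 = - of_nat r"
    hence "s = 1 - of_nat r" by (simp add: algebra_simps)
    thus False using s by auto
  qed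
  define S where "S = of_real pi / sin (of_real pi * s)"
  note js = jensen_series[OF z \<epsilon> s0]
  have S': "of_real pi / sin (of_real pi * (s - 1)) = - S"
    by (simp add: S_def right_diff_distrib sin_diff flip: sin_of_real cos_of_real)
  interpret finite_measure unit_lborel by (rule finite_measure_unit_lborel)
  have pw: "of_real \<epsilon> powr s / of_real \<epsilon> * (inc_beta s (of_real \<epsilon> * x) - S) =
      gpow \<epsilon> (s - 1) x / (s - 1) + of_real \<epsilon> * x * (\<integral>t. gpow \<epsilon> (s - 1) (of_real t * x) \<partial>unit_lborel)"
    if x: "Re x > 0" for x
  proof -
    define X where "X = of_real \<epsilon> * x"
    have X: "Re X > 0" using x \<epsilon> by (simp add: X_def)
    have p: "of_real \<epsilon> powr s / of_real \<epsilon> = of_real \<epsilon> powr (s - 1)"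
      using \<epsilon> by (simp add: powr_diff)
    have "inc_beta s X = gpow 1 (s - 1) X / (s - 1) - inc_beta (s - 1) X"
    proof -
      have "s - 1 \<noteq> 0" using s1[of 0] by simp
      thus ?thesis using inc_beta_recurrence[OF X s1] by (simp add: field_simps)
    qed
    moreover have "- S - inc_beta (s - 1) X = X * (\<integral>t. gpow 1 (s - 1) (of_real t * X) \<partial>unit_lborel)"
      using inc_beta_complement[OF _ s1 X] s S' by simp
    ultimately have "inc_beta s X - S = gpow 1 (s - 1) X / (s - 1) + X * (\<integral>t. gpow 1 (s - 1) (of_real t * X) \<partial>unit_lborel)"
      by (metis add_diff_eq diff_add_cancel add.commute diff_diff_eq2 minus_diff_commute uminus_add_conv_diff)
    hence "of_real \<epsilon> powr s / of_real \<epsilon> * (inc_beta s X - S) = of_real \<epsilon> powr (s - 1) * gpow 1 (s - 1) X / (s - 1) +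
       X * (\<integral>t. of_real \<epsilon> powr (s - 1) * gpow 1 (s - 1) (of_real t * X) \<partial>unit_lborel)"
      unfolding p by (simp add: algebra_simps)
    also have "of_real \<epsilon> powr (s - 1) * gpow 1 (s - 1) X = gpow \<epsilon> (s - 1) x"
      unfolding X_def by (rule gpow_scale[OF \<epsilon>(1) x])
    also have "(\<integral>t. of_real \<epsilon> powr (s - 1) * gpow 1 (s - 1) (of_real t * X) \<partial>unit_lborel) =
        (\<integral>t. gpow \<epsilon> (s - 1) (of_real t * x) \<partial>unit_lborel)"
    proof (rule Bochner_Integration.integral_cong[OF refl])
      fix t assume "t \<in> space unit_lborel"
      hence "t > 0" by auto
      thus "of_real \<epsilon> powr (s - 1) * gpow 1 (s - 1) (of_real t * X) = gpow \<epsilon> (s - 1) (of_real t * x)"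
        using gpow_scale[OF \<epsilon>(1), of "of_real t * x" "s - 1"] x by (simp add: X_def mult_ac)
    qed
    finally show ?thesis by (simp add: X_def)
  qed
  have "lattice_sum z \<epsilon> s = gpow 1 s (of_real \<epsilon> * z) + (\<integral>p. inc_beta s (of_real \<epsilon> * jline z p) \<partial>unit_lborel) / of_real \<epsilon>"
    unfolding lattice_sum_def lattice_term_def using js(2) by (simp add: sums_iff)
  hence "lattice_sum z \<epsilon> s - of_real pi / (of_real \<epsilon> * sin (of_real pi * s)) =
     gpow 1 s (of_real \<epsilon> * z) + ((\<integral>p. inc_beta s (of_real \<epsilon> * jline z p) \<partial>unit_lborel) - (\<integral>p. S \<partial>unit_lborel)) / of_real \<epsilon>"
    by (simp add: S_def measure_unit_lborel diff_divide_distrib)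
  also have "(\<integral>p. inc_beta s (of_real \<epsilon> * jline z p) \<partial>unit_lborel) - (\<integral>p. S \<partial>unit_lborel) =
       (\<integral>p. inc_beta s (of_real \<epsilon> * jline z p) - S \<partial>unit_lborel)"
    by (rule Bochner_Integration.integral_diff[symmetric]) (use js(1) in auto)
  finally have "of_real \<epsilon> powr s * (lattice_sum z \<epsilon> s - of_real pi / (of_real \<epsilon> * sin (of_real pi * s))) =
      gpow \<epsilon> s z + (\<integral>p. of_real \<epsilon> powr s / of_real \<epsilon> * (inc_beta s (of_real \<epsilon> * jline z p) - S) \<partial>unit_lborel)"
    by (simp add: distrib_left gpow_scale[OF \<epsilon>(1) z])
  also have "(\<integral>p. of_real \<epsilon> powr s / of_real \<epsilon> * (inc_beta s (of_real \<epsilon> * jline z p) - S) \<partial>unit_lborel) =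
     (\<integral>p. gpow \<epsilon> (s - 1) (jline z p) / (s - 1) +
     of_real \<epsilon> * jline z p * (\<integral>t. gpow \<epsilon> (s - 1) (of_real t * jline z p) \<partial>unit_lborel) \<partial>unit_lborel)"
    by (rule Bochner_Integration.integral_cong[OF refl], rule pw) (use z in simp)
  finally show ?thesis by (simp add: jensen_def)
qed

section \<open>Meromorphic continuation of the q-series\<close>

text \<open>Two continuations agree near a point of \<open>A\<close>, so by the identity theorem
  they agree off isolated points. \<open>remove_sings\<close> depends only on punctured
  neighbourhoods and does not see the choice made by \<open>SOME\<close>.\<close>

lemma mero_cont_eq_remove_sings:
  assumes F: "F meromorphic_on UNIV" "\<And>s. s \<in> A \<Longrightarrow> F s = f s" and A: "open A" "A \<noteq> {}"
  shows "mero_cont f A = remove_sings F"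
proof -
  define G where "G = (SOME F. F meromorphic_on UNIV \<and> (\<forall>s\<in>A. F s = f s))"
  have "G meromorphic_on UNIV \<and> (\<forall>s\<in>A. G s = f s)"
    unfolding G_def by (rule someI[of _ F]) (use F in auto)
  hence G: "G meromorphic_on UNIV" "\<And>s. s \<in> A \<Longrightarrow> G s = f s" by auto
  define H where "H = (\<lambda>s. G s - F s)"
  have H: "H meromorphic_on UNIV" unfolding H_def by (intro meromorphic_intros G F)
  have ev_H: "\<forall>\<^sub>F w in at s. remove_sings H w = H w" for s
    by (rule eventually_remove_sings_eq_at, rule meromorphic_on_isolated_singularity,
        rule meromorphic_on_subset[OF H]) auto
  obtain a where a: "a \<in> A" using A by blast
  have "\<forall>\<^sub>F w in at a. w \<in> A"
    using eventually_nhds_in_open[OF A(1) a] by (auto simp: eventually_at_filter elim: eventually_mono)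
  hence "\<forall>\<^sub>F w in at a. remove_sings H w = 0"
    using ev_H[of a] by eventually_elim (auto simp: H_def G F)
  hence "\<exists>\<^sub>F w in at a. remove_sings H w = 0"
    by (intro eventually_frequently) auto
  from frequently_eq_meromorphic_imp_constant[OF this remove_sings_nicely_meromorphic[OF H]]
  have H0: "remove_sings H w = 0" for w by auto
  have "remove_sings G s = remove_sings F s" for s
  proof (rule remove_sings_cong)
    show "\<forall>\<^sub>F w in at s. G w = F w"
      using ev_H[of s] by eventually_elim (simp add: H0, simp add: H_def)
  qed auto
  thus ?thesis unfolding mero_cont_def G_def by auto
qed

text \<open>From N on Re (w + r) >= 1 throughout the disc, so the denominators have norm at least 1
  - e^(-\<open>\<epsilon>\<close>), and the Weierstrass test with a real binomial series makes the
  tail holomorphic.\<close>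

lemma lattice_sum_split:
  assumes z: "Re z > 0" and \<epsilon>: "\<epsilon> > 0"
  obtains N g where "g holomorphic_on ball 0 R"
    "\<forall>w\<in>ball 0 R. lattice_sum z \<epsilon> w = (\<Sum>r<N. lattice_term z \<epsilon> r w) + g w"
proof -
  define \<rho> where "\<rho> = exp (- \<epsilon> * Re z)"
  have \<rho>: "0 < \<rho>" "\<rho> < 1" using z \<epsilon> by (auto simp: \<rho>_def)
  define K where "K = exp (\<epsilon> * \<bar>R\<bar> * norm z) / (1 - exp (-\<epsilon>))"
  define N where "N = nat \<lceil>\<bar>R\<bar> + 1\<rceil>"
  have bound: "norm (lattice_term z \<epsilon> r w) \<le> K * (neg_binom \<bar>R\<bar> r * \<rho> ^ r)" and ne: "exp (- (of_real \<epsilon> * (w + of_nat r))) \<noteq> 1"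
    if w: "w \<in> ball 0 R" and r: "r \<ge> N" for r w
  proof -
    have wR: "norm w \<le> \<bar>R\<bar>" using w by auto
    have "real r \<ge> \<bar>R\<bar> + 1" using r unfolding N_def by linarith
    hence "Re w + real r \<ge> 1" using wR abs_Re_le_cmod[of w] by linarith
    hence "\<epsilon> * 1 \<le> \<epsilon> * (Re w + real r)" using \<epsilon> by (intro mult_left_mono) auto
    hence n1: "norm (exp (- (of_real \<epsilon> * (w + of_nat r)))) \<le> exp (-\<epsilon>)"
      by (simp add: norm_exp_eq_Re)
    hence d: "1 - exp (-\<epsilon>) \<le> norm (1 - exp (- (of_real \<epsilon> * (w + of_nat r))))"
      using n1 norm_triangle_ineq2[of 1 "exp (- (of_real \<epsilon> * (w + of_nat r)))"]
      unfolding norm_one by linarith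
    thus "exp (- (of_real \<epsilon> * (w + of_nat r))) \<noteq> 1" using \<epsilon> by auto
    have "exp (- (of_real \<epsilon> * (w + of_nat r)) * z) = exp (- (of_real \<epsilon> * w * z)) * exp (- (of_real \<epsilon> * z)) ^ r"
      by (simp add: algebra_simps flip: exp_of_nat_mult exp_add)
    moreover have "norm (exp (- (of_real \<epsilon> * w * z))) \<le> exp (\<epsilon> * \<bar>R\<bar> * norm z)"
    proof -
      have "Re (- (of_real \<epsilon> * w * z)) \<le> norm (of_real \<epsilon> * w * z)"
        by (metis complex_Re_le_cmod norm_minus_cancel)
      also have "\<dots> = \<epsilon> * norm w * norm z" using \<epsilon> by (simp add: norm_mult)
      also have "\<dots> \<le> \<epsilon> * \<bar>R\<bar> * norm z" using wR \<epsilon> by (intro mult_right_mono mult_left_mono) auto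
      finally show ?thesis by (simp add: norm_exp_eq_Re)
    qed
    ultimately have e: "norm (exp (- (of_real \<epsilon> * (w + of_nat r)) * z)) \<le> exp (\<epsilon> * \<bar>R\<bar> * norm z) * \<rho> ^ r"
      using \<rho> by (simp add: norm_mult norm_power norm_exp_eq_Re \<rho>_def mult_right_mono)
    have "norm (lattice_term z \<epsilon> r w) \<le> neg_binom \<bar>R\<bar> r * (exp (\<epsilon> * \<bar>R\<bar> * norm z) * \<rho> ^ r) / (1 - exp (-\<epsilon>))"
      unfolding lattice_term_def norm_divide norm_mult[of "neg_binom w r"]
      using \<epsilon> \<rho> by (intro frac_le mult_mono norm_neg_binom_le wR e d) (auto intro!: neg_binom_nonneg mult_nonneg_nonneg)
    thus "norm (lattice_term z \<epsilon> r w) \<le> K * (neg_binom \<bar>R\<bar> r * \<rho> ^ r)" by (simp add: K_def mult_ac)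
  qed
  have sumM: "summable (\<lambda>r. K * (neg_binom \<bar>R\<bar> r * \<rho> ^ r))"
    using \<rho> by (intro summable_mult summable_neg_binom_real) auto
  define g where "g = (\<lambda>w. \<Sum>r. lattice_term z \<epsilon> (r + N) w)"
  have unif: "uniform_limit (ball 0 R) (\<lambda>n w. \<Sum>r<n. lattice_term z \<epsilon> (r + N) w) g sequentially"
    unfolding g_def
    by (rule Weierstrass_m_test[OF bound summable_ignore_initial_segment[OF sumM]]) auto
  have summ: "summable (\<lambda>r. lattice_term z \<epsilon> r w)" if "w \<in> ball 0 R" for w
    by (rule summable_comparison_test'[OF sumM, of N]) (use bound that in auto)
  show ?thesis
  proof (rule that[of g N])
    show "g holomorphic_on ball 0 R"
    proof (rule holomorphic_uniform_sequence[where f = "\<lambda>n w. \<Sum>r<n. lattice_term z \<epsilon> (r + N) w"])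
      show "(\<lambda>w. \<Sum>r<n. lattice_term z \<epsilon> (r + N) w) holomorphic_on ball 0 R" for n
        unfolding lattice_term_def neg_binom_def
      proof (intro holomorphic_intros)
        fix r and w :: complex assume "w \<in> ball 0 R"
        thus "1 - exp (- (of_real \<epsilon> * (w + of_nat (r + N)))) \<noteq> 0" using ne[of w "r + N"] by auto
      qed auto
      fix x :: complex assume "x \<in> ball 0 R"
      then obtain d where "d > 0" "cball x d \<subseteq> ball 0 R" by (meson open_ball open_contains_cball)
      thus "\<exists>d>0. cball x d \<subseteq> ball 0 R \<and> uniform_limit (cball x d) (\<lambda>n w. \<Sum>r<n. lattice_term z \<epsilon> (r + N) w) g sequentially"
        using uniform_limit_on_subset[OF unif] by blast
    qed auto
    show "\<forall>w\<in>ball 0 R. lattice_sum z \<epsilon> w = (\<Sum>r<N. lattice_term z \<epsilon> r w) + g w"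
      unfolding lattice_sum_def g_def using suminf_split_initial_segment[OF summ, of _ N]
      by (auto simp: add.commute)
  qed
qed

lemma lattice_sum_meromorphic:
  assumes "Re z > 0" "\<epsilon> > 0"
  shows "lattice_sum z \<epsilon> meromorphic_on UNIV"
proof (rule iffD2[OF meromorphic_on_meromorphic_at], rule ballI)
  fix w :: complex
  define R where "R = norm w + 1"
  obtain N g where g: "g holomorphic_on ball 0 R" "\<forall>w\<in>ball 0 R. lattice_sum z \<epsilon> w = (\<Sum>r<N. lattice_term z \<epsilon> r w) + g w"
    using lattice_sum_split[OF assms, of R] by blast
  have w: "w \<in> ball 0 R" by (simp add: R_def)
  have "g meromorphic_on {w}"
    using g(1) w by (intro analytic_on_imp_meromorphic_on holomorphic_on_imp_analytic_at) auto
  moreover have "lattice_term z \<epsilon> r meromorphic_on {w}" for r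
    unfolding lattice_term_def neg_binom_def
    by (intro meromorphic_on_divide analytic_on_imp_meromorphic_on holomorphic_on_imp_analytic_at[of _ UNIV]
          holomorphic_intros) auto
  ultimately have "(\<lambda>w. (\<Sum>r<N. lattice_term z \<epsilon> r w) + g w) meromorphic_on {w}"
    by (intro meromorphic_intros)
  moreover have "\<forall>\<^sub>F v in at w. (\<Sum>r<N. lattice_term z \<epsilon> r v) + g v = lattice_sum z \<epsilon> v"
    using eventually_nhds_in_open[OF open_ball w] g(2) by (auto simp: eventually_at_filter elim!: eventually_mono)
  ultimately show "lattice_sum z \<epsilon> meromorphic_on {w}"
    by (subst (asm) meromorphic_on_cong[of "{w}" _ "lattice_sum z \<epsilon>"]) auto
qed

lemma lattice_sum_analytic_at:
  assumes "Re z > 0" "\<epsilon> > 0" and w: "Re w > 0"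
  shows "lattice_sum z \<epsilon> analytic_on {w}"
proof -
  define R where "R = norm w + 1"
  obtain N g where g: "g holomorphic_on ball 0 R" "\<forall>w\<in>ball 0 R. lattice_sum z \<epsilon> w = (\<Sum>r<N. lattice_term z \<epsilon> r w) + g w"
    using lattice_sum_split[OF assms(1,2), of R] by blast
  define S where "S = ball 0 R \<inter> {w. Re w > 0}"
  have S: "open S" "w \<in> S" using w by (auto simp: S_def R_def open_halfspace_Re_gt)
  have "(\<lambda>w. (\<Sum>r<N. lattice_term z \<epsilon> r w) + g w) holomorphic_on S"
    unfolding lattice_term_def neg_binom_def
  proof (intro holomorphic_intros)
    fix r v assume "v \<in> S"
    hence "Re (of_real \<epsilon> * (v + of_nat r)) > 0" using assms(2) by (auto simp: S_def add_pos_nonneg)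
    thus "1 - exp (- (of_real \<epsilon> * (v + of_nat r))) \<noteq> 0"
      using Re_expm_pos by (metis less_irrefl zero_complex.sel(1))
  qed (use g(1) in \<open>auto simp: S_def intro: holomorphic_on_subset\<close>)
  hence "lattice_sum z \<epsilon> holomorphic_on S"
    by (rule holomorphic_transform) (use g(2) in \<open>auto simp: S_def\<close>)
  thus ?thesis using S analytic_at by blast
qed

text \<open>Binomial expansion in e^(-x), exchange of the two sums, and geometric summation over k.
  The product majorant \<open>C r * \<beta> ^ k\<close> justifies the exchange.\<close>

lemma gpow_sums_lattice_sum:
  assumes z: "Re z > 0" and \<epsilon>: "\<epsilon> > 0" and w: "Re w > 0"
  shows "(\<lambda>k. gpow 1 w (of_real \<epsilon> * (of_nat k + z))) sums lattice_sum z \<epsilon> w"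
proof -
  define a where "a = (\<lambda>r. of_real \<epsilon> * (w + of_nat r))"
  define f where "f = (\<lambda>r k. neg_binom w r * exp (- a r * z) * exp (- a r) ^ k)"
  define \<rho> \<beta> where "\<rho> = exp (- \<epsilon> * Re z)" and "\<beta> = exp (- \<epsilon> * Re w)"
  have \<rho>: "0 < \<rho>" "\<rho> < 1" and \<beta>: "0 < \<beta>" "\<beta> < 1" using z w \<epsilon> by (auto simp: \<rho>_def \<beta>_def)
  define C where "C = (\<lambda>r. neg_binom (norm w) r * (norm (exp (- (of_real \<epsilon> * w * z))) * \<rho> ^ r))"
  have C0: "C r \<ge> 0" for r using \<rho> by (auto simp: C_def neg_binom_nonneg)
  have sumC: "summable C"
    using summable_mult[OF summable_neg_binom_real[of \<rho> "norm w"], of "norm (exp (- (of_real \<epsilon> * w * z)))"] \<rho>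
    by (simp add: C_def mult_ac)
  have nb: "norm (exp (- a r)) \<le> \<beta>" for r
    using \<epsilon> by (simp add: norm_exp_eq_Re a_def \<beta>_def)
  have bound: "norm (f r k) \<le> C r * \<beta> ^ k" for r k
  proof -
    have "exp (- a r * z) = exp (- (of_real \<epsilon> * w * z)) * exp (- (of_real \<epsilon> * z)) ^ r"
      by (simp add: a_def algebra_simps flip: exp_of_nat_mult exp_add)
    hence "norm (exp (- a r * z)) = norm (exp (- (of_real \<epsilon> * w * z))) * \<rho> ^ r"
      by (simp add: norm_mult norm_power \<rho>_def norm_exp_eq_Re)
    thus ?thesis unfolding f_def norm_mult C_def norm_power
      using nb \<rho> by (intro mult_mono power_mono norm_neg_binom_le)
        (auto intro!: mult_nonneg_nonneg neg_binom_nonneg)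
  qed
  have geo: "summable (\<lambda>k. C r * \<beta> ^ k)" for r
    using \<beta> by (intro summable_mult summable_geometric) auto
  have sum_k: "summable (\<lambda>k. norm (f r k))" for r
    by (rule summable_comparison_test'[OF geo, of 0]) (use bound in auto)
  \<comment> \<open>Sums over k are treated as integrals for the counting measure, so that the
    exchange theorem for series and integrals applies.\<close>
  have int: "integrable (count_space UNIV) (f r)" for r
    using sum_k by (simp add: integrable_count_space_nat_iff)
  have AE: "AE k in count_space UNIV. summable (\<lambda>r. norm (f r k))"
  proof (rule AE_I2)
    fix k
    show "summable (\<lambda>r. norm (f r k))"
      by (rule summable_comparison_test'[OF summable_mult2[OF sumC], of 0]) (use bound in auto)
  qed
  have sum_int: "summable (\<lambda>r. \<integral>k. norm (f r k) \<partial>count_space UNIV)"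
  proof (rule summable_comparison_test'[OF summable_mult2[OF sumC, of "\<Sum>k. \<beta> ^ k"], of 0])
    fix r
    have "(\<integral>k. norm (f r k) \<partial>count_space UNIV) = (\<Sum>k. norm (f r k))"
      using int by (intro integral_count_space_nat) auto
    also have "\<dots> \<le> (\<Sum>k. C r * \<beta> ^ k)" by (intro suminf_le bound sum_k geo)
    also have "\<dots> = C r * (\<Sum>k. \<beta> ^ k)"
      using \<beta> by (intro suminf_mult summable_geometric) auto
    finally show "norm (\<integral>k. norm (f r k) \<partial>count_space UNIV) \<le> C r * (\<Sum>k. \<beta> ^ k)"
      by simp
  qed
  have "(\<Sum>r. f r k) = gpow 1 w (of_real \<epsilon> * (of_nat k + z))" for k
  proof -
    define x where "x = of_real \<epsilon> * (of_nat k + z)"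
    have "norm (exp (- x)) < 1" using z \<epsilon> by (simp add: norm_exp_eq_Re x_def add_nonneg_pos)
    from sums_mult[OF neg_binom_sums[OF this], of "exp (- w * x)" w]
    have "(\<lambda>r. f r k) sums gpow 1 w x"
      unfolding gpow_1 by (simp add: f_def a_def x_def algebra_simps flip: exp_of_nat_mult exp_add)
    thus ?thesis by (simp add: sums_iff x_def)
  qed
  note suminf_f = this
  have "integrable (count_space UNIV) (\<lambda>k. \<Sum>r. f r k)"
    by (rule integrable_suminf[OF int AE sum_int])
  hence i: "integrable (count_space UNIV) (\<lambda>k. gpow 1 w (of_real \<epsilon> * (of_nat k + z)))"
    by (simp add: suminf_f)
  have "(\<lambda>r. \<integral>k. f r k \<partial>count_space UNIV) sums (\<integral>k. (\<Sum>r. f r k) \<partial>count_space UNIV)"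
    by (rule sums_integral[OF int AE sum_int])
  also have "(\<lambda>r. \<integral>k. f r k \<partial>count_space UNIV) = (\<lambda>r. neg_binom w r * exp (- a r * z) / (1 - exp (- a r)))"
  proof
    fix r
    have "(\<integral>k. f r k \<partial>count_space UNIV) = (\<Sum>k. f r k)"
      by (rule integral_count_space_nat[OF int])
    also have "\<dots> = neg_binom w r * exp (- a r * z) * (1 / (1 - exp (- a r)))"
    proof -
      have lt: "norm (exp (- a r)) < 1" using nb[of r] \<beta>(2) by linarith
      show ?thesis
        unfolding f_def by (simp only: suminf_mult[OF summable_geometric[OF lt]] suminf_geometric[OF lt])
    qed
    finally show "(\<integral>k. f r k \<partial>count_space UNIV) = neg_binom w r * exp (- a r * z) / (1 - exp (- a r))"
      by simp
  qed
  also have "(\<integral>k. (\<Sum>r. f r k) \<partial>count_space UNIV) = (\<Sum>k. gpow 1 w (of_real \<epsilon> * (of_nat k + z)))"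
    unfolding suminf_f by (rule integral_count_space_nat[OF i])
  finally have "lattice_sum z \<epsilon> w = (\<Sum>k. gpow 1 w (of_real \<epsilon> * (of_nat k + z)))"
    by (simp add: lattice_sum_def lattice_term_def a_def sums_iff)
  moreover have "summable (\<lambda>k. gpow 1 w (of_real \<epsilon> * (of_nat k + z)))"
    using i by (simp add: integrable_count_space_nat_iff summable_norm_cancel)
  ultimately show ?thesis by (simp add: summable_sums)
qed

section \<open>The Hurwitz zeta function\<close>

text \<open>The factor lost in \<open>norm_expm_arc_ge\<close> cancels against the modulus of the
  exponential in \<open>gpow\<close>. What remains is uniform for bounded
  \<open>\<epsilon>\<close>.\<close>

lemma norm_gpow_le:
  assumes "\<epsilon> \<ge> 0" "Re x > 0" "Re w \<ge> 0"
  shows "norm (gpow \<epsilon> w x) \<le> exp (\<bar>Im w\<bar> * (\<epsilon> * \<bar>Im x\<bar> + pi)) * Re x powr (- Re w)"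
proof -
  define m where "m = expm_arc \<epsilon> x"
  have m0: "m \<noteq> 0" using Re_expm_arc_pos[OF assms(1,2)] by (auto simp: m_def)
  have "norm (m powr (-w)) \<le> norm m powr (- Re w) * exp (\<bar>Im w\<bar> * pi)"
    using norm_powr_le[OF m0, of "-w"] by simp
  also have "norm m powr (- Re w) \<le> (Re x * exp (- \<epsilon> * Re x)) powr (- Re w)"
    using norm_expm_arc_ge[OF assms(1,2)] assms by (intro powr_mono2') (auto simp: m_def)
  also have "\<dots> = Re x powr (- Re w) * exp (\<epsilon> * Re w * Re x)"
    using assms by (simp add: powr_mult exp_powr_real mult_ac)
  finally have 1: "norm (m powr (-w)) \<le> Re x powr (- Re w) * exp (\<epsilon> * Re w * Re x) * exp (\<bar>Im w\<bar> * pi)"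
    by simp
  have "Im w * (\<epsilon> * Im x) \<le> \<bar>Im w * (\<epsilon> * Im x)\<bar>" by simp
  also have "\<dots> = \<bar>Im w\<bar> * (\<epsilon> * \<bar>Im x\<bar>)" using assms by (simp add: abs_mult)
  finally have "Re (- w * of_real \<epsilon> * x) \<le> - (\<epsilon> * Re w * Re x) + \<bar>Im w\<bar> * (\<epsilon> * \<bar>Im x\<bar>)"
    by (simp add: algebra_simps)
  hence 2: "norm (exp (- w * of_real \<epsilon> * x)) \<le> exp (- (\<epsilon> * Re w * Re x) + \<bar>Im w\<bar> * (\<epsilon> * \<bar>Im x\<bar>))"
    by (simp only: norm_exp_eq_Re exp_le_cancel_iff)
  have "norm (gpow \<epsilon> w x) \<le> exp (- (\<epsilon> * Re w * Re x) + \<bar>Im w\<bar> * (\<epsilon> * \<bar>Im x\<bar>)) *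
      (Re x powr (- Re w) * exp (\<epsilon> * Re w * Re x) * exp (\<bar>Im w\<bar> * pi))"
    unfolding gpow_def norm_mult m_def[symmetric] by (intro mult_mono 1 2) auto
  also have "\<dots> = exp (\<bar>Im w\<bar> * (\<epsilon> * \<bar>Im x\<bar> + pi)) * Re x powr (- Re w)"
  proof -
    have "exp (- (\<epsilon> * Re w * Re x) + \<bar>Im w\<bar> * (\<epsilon> * \<bar>Im x\<bar>)) * exp (\<epsilon> * Re w * Re x) * exp (\<bar>Im w\<bar> * pi)
        = exp (\<bar>Im w\<bar> * (\<epsilon> * \<bar>Im x\<bar> + pi))"
      by (simp add: algebra_simps flip: exp_add)
    thus ?thesis by (metis mult.assoc mult.commute)
  qed
  finally show ?thesis .
qed

lemma summable_shifted_powr: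
  fixes \<xi> \<sigma> :: real
  assumes "\<xi> > 0" "\<sigma> > 1"
  shows "summable (\<lambda>k. (real k + \<xi>) powr (-\<sigma>))"
proof (rule summable_comparison_test'[of "\<lambda>k. real k powr (-\<sigma>)" 1])
  show "summable (\<lambda>k. real k powr (-\<sigma>))"
    using assms summable_real_powr_iff[of "-\<sigma>"] by simp
  show "norm ((real k + \<xi>) powr (-\<sigma>)) \<le> real k powr (-\<sigma>)" if "k \<ge> 1" for k
    using that assms by (auto intro!: powr_mono2')
qed

text \<open>Tannery's theorem. All points k + z have the same imaginary part, so
  \<open>norm_gpow_le\<close> gives one majorant for all \<open>\<epsilon> < 1\<close>, summable
  because Re s > 1.\<close>

lemma tendsto_gpow_series:
  assumes z: "Re z > 0" and s: "Re s > 1"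
  shows "((\<lambda>\<epsilon>. \<Sum>k. gpow \<epsilon> s (of_nat k + z)) \<longlongrightarrow> (\<Sum>k. (of_nat k + z) powr (-s))) (at_right 0)"
proof -
  define M where "M = (\<lambda>k. exp (\<bar>Im s\<bar> * (\<bar>Im z\<bar> + pi)) * (real k + Re z) powr (- Re s))"
  have "eventually (\<lambda>\<epsilon>. \<epsilon> \<in> {0<..<1}) (at_right (0::real))"
    by (rule eventually_at_right_real) auto
  hence ev: "eventually (\<lambda>\<epsilon>. \<forall>k. norm (gpow \<epsilon> s (of_nat k + z)) \<le> M k) (at_right 0)"
  proof eventually_elim
    case (elim \<epsilon>)
    show ?case
    proof
      fix k
      have "norm (gpow \<epsilon> s (of_nat k + z)) \<le> exp (\<bar>Im s\<bar> * (\<epsilon> * \<bar>Im (of_nat k + z)\<bar> + pi)) * Re (of_nat k + z) powr (- Re s)"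
        using elim z s by (intro norm_gpow_le) auto
      also have "\<dots> \<le> M k"
        unfolding M_def using elim mult_right_mono[of \<epsilon> 1 "\<bar>Im z\<bar>"]
        by (intro mult_mono) (auto intro!: mult_left_mono)
      finally show "norm (gpow \<epsilon> s (of_nat k + z)) \<le> M k" .
    qed
  qed
  have lim: "((\<lambda>\<epsilon>. gpow \<epsilon> s (of_nat k + z)) \<longlongrightarrow> (of_nat k + z) powr (-s)) (at_right 0)" for k
  proof -
    have "continuous_on {0..} (\<lambda>\<epsilon>. gpow \<epsilon> s (of_nat k + z))"
      by (intro continuous_on_gpow continuous_intros) (use z in auto)
    hence "((\<lambda>\<epsilon>. gpow \<epsilon> s (of_nat k + z)) \<longlongrightarrow> gpow 0 s (of_nat k + z)) (at 0 within {0..})"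
      unfolding continuous_on_def by (rule bspec) auto
    hence "((\<lambda>\<epsilon>. gpow \<epsilon> s (of_nat k + z)) \<longlongrightarrow> gpow 0 s (of_nat k + z)) (at_right 0)"
      by (rule tendsto_within_subset) auto
    thus ?thesis by (simp add: gpow_0)
  qed
  have bound: "eventually (\<lambda>(k, \<epsilon>). norm (gpow \<epsilon> s (of_nat k + z)) \<le> M k) (sequentially \<times>\<^sub>F at_right 0)"
    unfolding eventually_prod_filter
    by (rule exI[of _ "\<lambda>_. True"], rule exI, intro conjI, rule eventually_True, rule ev) auto
  have "summable M"
    unfolding M_def using z s by (intro summable_mult summable_shifted_powr) auto
  from tannerys_theorem[OF lim bound this] show ?thesis by simp
qed

lemma hurwitz_series_holomorphic:
  assumes z: "Re z > 0"
  shows "(\<lambda>w. \<Sum>k. (of_nat k + z) powr (-w)) holomorphic_on {w. Re w > 1}"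
proof (rule holomorphic_uniform_sequence[where f = "\<lambda>n w. \<Sum>k<n. (of_nat k + z) powr (-w)"])
  show "(\<lambda>w. \<Sum>k<n. (of_nat k + z) powr (-w)) holomorphic_on {w. Re w > 1}" for n
  proof -
    have "of_nat k + z \<noteq> 0" for k using z by (auto simp: complex_eq_iff add_nonneg_eq_0_iff)
    hence "(\<lambda>w. \<Sum>k<n. (of_nat k + z) powr (-w)) = (\<lambda>w. \<Sum>k<n. exp (- w * Ln (of_nat k + z)))"
      by (simp add: powr_def)
    thus ?thesis by (auto intro!: holomorphic_intros)
  qed
  fix w :: complex assume w: "w \<in> {w. Re w > 1}"
  define d where "d = (Re w - 1) / 2"
  have d: "d > 0" using w by (simp add: d_def)
  have sub: "cball w d \<subseteq> {v. Re v \<ge> 1 + d \<and> \<bar>Im v\<bar> \<le> \<bar>Im w\<bar> + d}"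
  proof
    fix v assume "v \<in> cball w d"
    hence "norm (w - v) \<le> d" by (simp add: dist_norm)
    hence "\<bar>Re w - Re v\<bar> \<le> d" "\<bar>Im w - Im v\<bar> \<le> d"
      using abs_Re_le_cmod[of "w - v"] abs_Im_le_cmod[of "w - v"] by auto
    thus "v \<in> {v. Re v \<ge> 1 + d \<and> \<bar>Im v\<bar> \<le> \<bar>Im w\<bar> + d}" 
    proof -
      have "1 + d = Re w - d" by (simp add: d_def field_simps)
      thus ?thesis using \<open>\<bar>Re w - Re v\<bar> \<le> d\<close> \<open>\<bar>Im w - Im v\<bar> \<le> d\<close> by auto
    qed
  qed
  have "uniform_limit (cball w d) (\<lambda>n w. \<Sum>k<n. (of_nat k + z) powr (-w)) (\<lambda>w. \<Sum>k. (of_nat k + z) powr (-w)) sequentially"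
  proof (rule Weierstrass_m_test_ev)
    show "summable (\<lambda>k. exp ((\<bar>Im w\<bar> + d) * pi) * (real k + Re z) powr (- (1 + d)))"
      using z d by (intro summable_mult summable_shifted_powr) auto
    show "\<forall>\<^sub>F k in sequentially. \<forall>v\<in>cball w d. norm ((of_nat k + z) powr (-v)) \<le> exp ((\<bar>Im w\<bar> + d) * pi) * (real k + Re z) powr (- (1 + d))"
      \<comment> \<open>For k >= 1 the base k + Re z exceeds 1, so its powers are monotone in the
        exponent.\<close>
      using eventually_ge_at_top[of 1]
    proof eventually_elim
      case (elim k)
      show ?case
      proof
        fix v assume "v \<in> cball w d"
        hence v: "Re v \<ge> 1 + d" "\<bar>Im v\<bar> \<le> \<bar>Im w\<bar> + d" using sub by auto
        have "norm (gpow 0 v (of_nat k + z)) \<le> exp (\<bar>Im v\<bar> * (0 * \<bar>Im (of_nat k + z)\<bar> + pi)) * Re (of_nat k + z) powr (- Re v)"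
          using z v d by (intro norm_gpow_le) auto
        also have "\<dots> \<le> exp ((\<bar>Im w\<bar> + d) * pi) * (real k + Re z) powr (- (1 + d))"
          using v elim z by (intro mult_mono powr_mono) auto
        finally show "norm ((of_nat k + z) powr (-v)) \<le> exp ((\<bar>Im w\<bar> + d) * pi) * (real k + Re z) powr (- (1 + d))"
          by (simp add: gpow_0)
      qed
    qed
  qed
  moreover have "cball w d \<subseteq> {w. Re w > 1}" using sub d by force
  ultimately show "\<exists>d>0. cball w d \<subseteq> {w. Re w > 1} \<and>
     uniform_limit (cball w d) (\<lambda>n w. \<Sum>k<n. (of_nat k + z) powr (-w)) (\<lambda>w. \<Sum>k. (of_nat k + z) powr (-w)) sequentially"
    using d by blast
qed (simp add: open_halfspace_Re_gt)

section \<open>Jensen's integral as the continuation of the Hurwitz series\<close>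

definition jensen_kernel :: "complex \<Rightarrow> complex \<Rightarrow> complex" where
  "jensen_kernel z w = (\<integral>p. exp (w * - Ln (jline z p)) \<partial>unit_lborel)"

lemma jensen_0:
  assumes "Re z > 0"
  shows "jensen z 0 s = z powr (-s) + jensen_kernel z (s - 1) / (s - 1)"
proof -
  have "jline z p \<noteq> 0" for p using assms Re_jline[of z p] by (metis add_pos_pos half_gt_zero_iff less_irrefl zero_complex.sel(1) zero_less_one)
  thus ?thesis by (simp add: jensen_def gpow_0 jensen_kernel_def powr_def algebra_simps)
qed

text \<open>On the disc of radius R, \<open>gpow_bound\<close> at \<open>\<epsilon> = 0\<close> and
  t = 1 dominates the integrand. Hence \<open>jensen z 0\<close> can be singular only at 1.\<close>

lemma jensen_kernel_holomorphic:
  assumes z: "Re z > 0"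
  shows "jensen_kernel z holomorphic_on UNIV"
proof -
  have "jensen_kernel z holomorphic_on ball 0 R" if R: "R \<ge> 1" for R
    unfolding jensen_kernel_def[abs_def]
  proof -
    obtain C where C: "C \<ge> 0"
      "\<And>\<epsilon> w x t. 0 \<le> \<epsilon> \<Longrightarrow> \<epsilon> * R \<le> 1 \<Longrightarrow> norm w \<le> R \<Longrightarrow> Re w \<le> R \<Longrightarrow> Re x = Re z + 1 / 2 \<Longrightarrow> 0 < t \<Longrightarrow> t \<le> 1
        \<Longrightarrow> norm (gpow \<epsilon> w (of_real t * x)) \<le> C * t powr (-R) * exp (2 * norm x)"
      using gpow_bound[of "Re z + 1 / 2" R R] R z by auto
    show "(\<lambda>w. \<integral>p. exp (w * - Ln (jline z p)) \<partial>unit_lborel) holomorphic_on ball 0 R"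
    proof (rule integral_exp_holomorphic)
      show "continuous_on {0<..<1} (\<lambda>p. - Ln (jline z p))"
        by (intro continuous_intros) (use z in \<open>auto simp: complex_nonpos_Reals_iff\<close>)
      show "integrable unit_lborel (\<lambda>p. C * (exp (3 * (norm z + 1 / 2)) * (p powr (-1/2) * (1 - p) powr (-1/2))))"
        by (intro integrable_mult_right integrable_jline_majorant)
      fix w p assume w: "w \<in> ball (0::complex) R" and p: "0 < (p::real)" "p < 1"
      have "jline z p \<noteq> 0" using z Re_jline[of z p] by force
      hence "norm (exp (w * - Ln (jline z p))) = norm (gpow 0 w (of_real 1 * jline z p))"
        by (simp add: gpow_0 powr_def)
      also have "\<dots> \<le> C * 1 powr (-R) * exp (2 * norm (jline z p))"
        using w complex_Re_le_cmod[of w] by (intro C(2)) auto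
      also have "\<dots> \<le> C * exp (3 * norm (jline z p))"
        using C(1) by (auto intro!: mult_left_mono)
      also have "\<dots> \<le> C * (exp (3 * (norm z + 1 / 2)) * (p powr (-1/2) * (1 - p) powr (-1/2)))"
        by (intro mult_left_mono exp_norm_jline_le p C(1))
      finally show "norm (exp (w * - Ln (jline z p))) \<le> C * (exp (3 * (norm z + 1 / 2)) * (p powr (-1/2) * (1 - p) powr (-1/2)))" .
    qed auto
  qed
  hence "jensen_kernel z analytic_on {w}" for w
    by (rule holomorphic_on_imp_analytic_at[of _ "ball 0 (norm w + 1)"]) auto
  thus ?thesis by (metis analytic_on_analytic_at analytic_imp_holomorphic)
qed

lemma jensen_0_analytic:
  assumes z: "Re z > 0"
  shows "jensen z 0 analytic_on - {1}"
proof -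
  have z0: "z \<noteq> 0" using z by auto
  have "(\<lambda>s. exp (- s * Ln z) + jensen_kernel z (s - 1) / (s - 1)) holomorphic_on - {1}"
    by (intro holomorphic_intros holomorphic_on_compose_gen[OF _ jensen_kernel_holomorphic[OF z], unfolded o_def]) auto
  moreover have "jensen z 0 = (\<lambda>s. exp (- s * Ln z) + jensen_kernel z (s - 1) / (s - 1))"
    using z0 by (auto simp: jensen_0[OF z] powr_def)
  ultimately show ?thesis by (simp add: analytic_on_open open_Compl)
qed

lemma jensen_0_meromorphic:
  assumes z: "Re z > 0"
  shows "jensen z 0 meromorphic_on UNIV"
proof -
  have z0: "z \<noteq> 0" using z by auto
  have "(\<lambda>s. jensen_kernel z (s - 1)) holomorphic_on UNIV"
    by (intro holomorphic_intros holomorphic_on_compose_gen[OF _ jensen_kernel_holomorphic[OF z], unfolded o_def]) auto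
  hence "(\<lambda>s. exp (- s * Ln z) + jensen_kernel z (s - 1) / (s - 1)) meromorphic_on UNIV"
    by (intro meromorphic_on_add meromorphic_on_divide analytic_on_imp_meromorphic_on)
       (auto simp: analytic_on_open intro!: holomorphic_intros)
  moreover have "jensen z 0 = (\<lambda>s. exp (- s * Ln z) + jensen_kernel z (s - 1) / (s - 1))"
    using z0 by (auto simp: jensen_0[OF z] powr_def)
  ultimately show ?thesis by simp
qed

lemma scaled_lattice_sum:
  assumes z: "Re z > 0" and \<epsilon>: "\<epsilon> > 0" and w: "Re w > 0"
  shows "of_real \<epsilon> powr w * lattice_sum z \<epsilon> w = (\<Sum>k. gpow \<epsilon> w (of_nat k + z))"
proof -
  have "(\<lambda>k. of_real \<epsilon> powr w * gpow 1 w (of_real \<epsilon> * (of_nat k + z))) sums (of_real \<epsilon> powr w * lattice_sum z \<epsilon> w)"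
    by (intro sums_mult gpow_sums_lattice_sum assms)
  thus ?thesis using gpow_scale[OF \<epsilon>] z by (simp add: sums_iff)
qed

text \<open>The expression of the theorem for \<open>\<epsilon>\<close> = -ln q up to the factor
  \<open>q_ratio\<close>; division by ln q turns the plus sign into a minus.\<close>

definition regularized :: "complex \<Rightarrow> real \<Rightarrow> complex \<Rightarrow> complex" where
  "regularized z \<epsilon> w = of_real \<epsilon> powr w * (lattice_sum z \<epsilon> w - of_real pi / (of_real \<epsilon> * sin (of_real pi * w)))"

text \<open>The correction is a constant times \<open>\<epsilon>\<close> to the power s - 1, which
  tends to 0. What remains is the termwise limit.\<close>

lemma tendsto_regularized_series:
  assumes z: "Re z > 0" and s: "Re s > 1"
  shows "((\<lambda>\<epsilon>. regularized z \<epsilon> s) \<longlongrightarrow> (\<Sum>k. (of_nat k + z) powr (-s))) (at_right 0)"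
proof -
  have "((\<lambda>\<epsilon>::real. \<epsilon> powr (Re s - 1)) \<longlongrightarrow> 0 powr (Re s - 1)) (at_right 0)"
    by (intro tendsto_powr2 tendsto_intros) (use s in \<open>auto simp: eventually_at_filter\<close>)
  hence "((\<lambda>\<epsilon>::real. \<epsilon> powr (Re s - 1)) \<longlongrightarrow> 0) (at_right 0)" by simp
  hence "((\<lambda>\<epsilon>. complex_of_real \<epsilon> powr (s - 1)) \<longlongrightarrow> 0) (at_right 0)"
    by (rule Lim_null_comparison[rotated])
       (auto simp: eventually_at_filter norm_powr_real_powr)
  from tendsto_diff[OF tendsto_gpow_series[OF assms] tendsto_mult_left_zero[OF this, of "of_real pi / sin (of_real pi * s)"]]
  have "((\<lambda>\<epsilon>. (\<Sum>k. gpow \<epsilon> s (of_nat k + z)) - complex_of_real \<epsilon> powr (s - 1) * (of_real pi / sin (of_real pi * s)))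
      \<longlongrightarrow> (\<Sum>k. (of_nat k + z) powr (-s))) (at_right 0)" by simp
  moreover have "\<forall>\<^sub>F \<epsilon> in at_right 0. (\<Sum>k. gpow \<epsilon> s (of_nat k + z)) - complex_of_real \<epsilon> powr (s - 1) * (of_real pi / sin (of_real pi * s)) = regularized z \<epsilon> s"
  proof -
    have "(\<Sum>k. gpow \<epsilon> s (of_nat k + z)) - complex_of_real \<epsilon> powr (s - 1) * (of_real pi / sin (of_real pi * s)) = regularized z \<epsilon> s"
      if "\<epsilon> > 0" for \<epsilon>
      using that s by (simp add: regularized_def right_diff_distrib scaled_lattice_sum[OF z, symmetric] powr_diff)
    thus ?thesis by (auto simp: eventually_at_filter)
  qed
  ultimately show ?thesis by (rule Lim_transform_eventually)
qed

lemma tendsto_jensen: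
  assumes z: "Re z > 0" and s: "Re s < 2" "s \<noteq> 1"
  shows "((\<lambda>\<epsilon>. jensen z \<epsilon> s) \<longlongrightarrow> jensen z 0 s) (at_right 0)"
proof -
  obtain e where e: "e > 0" "continuous_on {0..e} (\<lambda>\<epsilon>. jensen z \<epsilon> s)"
    "\<And>\<epsilon>. 0 \<le> \<epsilon> \<Longrightarrow> \<epsilon> \<le> e \<Longrightarrow> isCont (jensen z \<epsilon>) s"
    using jensen_continuity[OF assms] by blast
  have "((\<lambda>\<epsilon>. jensen z \<epsilon> s) \<longlongrightarrow> jensen z 0 s) (at 0 within {0..e})"
    using bspec[OF e(2)[unfolded continuous_on_def], of 0] e(1) by simp
  thus ?thesis using e(1) by (simp add: at_within_Icc_at_right)
qed

lemma eventually_regularized_eq_jensen: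
  assumes z: "Re z > 0" and s: "Re s < 2" "s \<notin> \<int>"
  shows "\<forall>\<^sub>F \<epsilon> in at_right 0. regularized z \<epsilon> s = jensen z \<epsilon> s"
proof -
  have "\<forall>\<^sub>F \<epsilon> in at_right 0. \<epsilon> \<in> {0<..<1 / (norm s + 1)}"
    by (rule eventually_at_right_real) (auto intro: add_nonneg_pos)
  thus ?thesis
  proof eventually_elim
    case (elim \<epsilon>)
    have "0 < norm s + 1" by (simp add: add_nonneg_pos)
    hence "\<epsilon> * (norm s + 1) < 1" using elim by (simp add: pos_less_divide_eq)
    hence "\<epsilon> * norm s \<le> 1" using elim by (auto simp: algebra_simps)
    thus ?case unfolding regularized_def using elim by (intro lattice_sum_eq_jensen assms) auto
  qed
qed

text \<open>For 1 < Re s < 2 both sides are limits of \<open>regularized\<close>, which equals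
  \<open>jensen\<close> for small \<open>\<epsilon>\<close>. Both are holomorphic on Re s > 1, so
  the equality extends to this half-plane.\<close>

lemma jensen_0_eq_hurwitz_series:
  assumes z: "Re z > 0" and s: "Re s > 1"
  shows "jensen z 0 s = (\<Sum>k. (of_nat k + z) powr (-s))"
proof (rule analytic_continuation_open[where s = "{s. Re s > 1} \<inter> {s. Re s < 2}" and s' = "{s. Re s > 1}"
       and f = "jensen z 0" and g = "\<lambda>s. \<Sum>k. (of_nat k + z) powr (-s)"])
  show "{s. Re s > 1} \<inter> {s. Re s < 2} \<noteq> {}"
  proof -
    have "(3/2 :: complex) \<in> {s. Re s > 1} \<inter> {s. Re s < 2}" by simp
    thus ?thesis by blast
  qed
  show "jensen z 0 holomorphic_on {s. Re s > 1}"
    using jensen_0_analytic[OF z] by (auto intro: analytic_imp_holomorphic holomorphic_on_subset)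
  fix s assume s: "s \<in> {s. Re s > 1} \<inter> {s. Re s < 2}"
  have "s \<notin> \<int>"
  proof
    assume "s \<in> \<int>"
    then obtain n where "s = of_int n" by (auto elim: Ints_cases)
    thus False using s by auto
  qed
  hence "((\<lambda>\<epsilon>. jensen z \<epsilon> s) \<longlongrightarrow> (\<Sum>k. (of_nat k + z) powr (-s))) (at_right 0)"
    using s z by (intro Lim_transform_eventually[OF tendsto_regularized_series eventually_regularized_eq_jensen]) auto
  moreover have "((\<lambda>\<epsilon>. jensen z \<epsilon> s) \<longlongrightarrow> jensen z 0 s) (at_right 0)"
    using s z by (intro tendsto_jensen) auto
  ultimately show "jensen z 0 s = (\<Sum>k. (of_nat k + z) powr (-s))"
    by (intro tendsto_unique[OF _ _]) auto
qed (use s hurwitz_series_holomorphic[OF z] in \<open>auto intro!: open_Int open_halfspace_Re_gt open_halfspace_Re_lt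
        convex_connected convex_halfspace_Re_gt\<close>)

lemma hurwitz_zeta_eq_jensen:
  assumes z: "Re z > 0" and s: "s \<noteq> 1"
  shows "hurwitz_zeta s z = jensen z 0 s"
proof -
  have "{s. Re s > 1} \<noteq> {}" by (auto intro!: exI[of _ 2])
  hence "hurwitz_zeta s z = remove_sings (jensen z 0) s"
    unfolding hurwitz_zeta_def
    by (subst mero_cont_eq_remove_sings[where F = "jensen z 0"])
       (auto simp: jensen_0_meromorphic[OF z] jensen_0_eq_hurwitz_series[OF z] open_halfspace_Re_gt)
  also have "\<dots> = jensen z 0 s"
    using jensen_0_analytic[OF z] s by (intro remove_sings_at_analytic) (auto intro: analytic_on_subset)
  finally show ?thesis .
qed

section \<open>The limit\<close>

text \<open>The part of a term of the q-series that does not depend on k; the correction term of the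
  theorem carries the same factor.\<close>

definition q_factor :: "real \<Rightarrow> complex \<Rightarrow> complex \<Rightarrow> complex" where
  "q_factor q z w = complex_of_real (q - q\<^sup>2) powr w * complex_of_real q powr (- z * w)"

lemma q_factor_exp:
  assumes "0 < q" "q < 1"
  shows "q_factor q z w = exp (w * of_real (ln (q - q\<^sup>2)) - z * w * of_real (ln q))"
proof -
  have "q\<^sup>2 < q" using assms by (simp add: power2_eq_square)
  hence "Ln (complex_of_real (q - q\<^sup>2)) = of_real (ln (q - q\<^sup>2))" "complex_of_real (q - q\<^sup>2) \<noteq> 0"
    by (auto simp: Ln_of_real simp del: of_real_diff)
  thus ?thesis using assms
    by (simp add: q_factor_def powr_def Ln_of_real exp_diff exp_minus field_simps del: of_real_diff)
qed

text \<open>q^(w(k+1)) is q^(w(k+z)) times q^(w-wz), and the first factor is the exponential in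
  \<open>gpow\<close>. The positive real 1 - q comes out of the power of \<open>qnum\<close>, and
  (1-q)^w q^w = (q - q^2)^w.\<close>

lemma q_hurwitz_term:
  assumes q: "0 < q" "q < 1" and x: "Re (of_nat k + z) > 0"
  shows "complex_of_real q powr (w * (of_nat k + 1)) / qnum q (of_nat k + z) powr w =
    q_factor q z w * gpow 1 w (of_real (- ln q) * (of_nat k + z))"
proof -
  define L where "L = ln q"
  define U where "U = 1 - exp ((of_nat k + z) * of_real L)"
  have L: "L < 0" using q by (simp add: L_def)
  have "Re (- ((of_nat k + z) * of_real L)) > 0" using x L by (simp add: mult_pos_neg)
  hence U0: "U \<noteq> 0" using Re_expm_pos[of "- ((of_nat k + z) * of_real L)"] by (auto simp: U_def)
  have qp: "complex_of_real q powr v = exp (v * of_real L)" for v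
    using q by (simp add: powr_def Ln_of_real L_def)
  have "qnum q (of_nat k + z) = of_real (1 / (1 - q)) * U"
    by (simp add: qnum_def qp U_def)
  moreover have "Ln (of_real (1 / (1 - q)) * U) = - of_real (ln (1 - q)) + Ln U"
    using q U0 by (subst Ln_times_of_real) (simp_all add: Ln_of_real ln_div del: of_real_divide)
  ultimately have den: "qnum q (of_nat k + z) powr w = exp (w * (Ln U - of_real (ln (1 - q))))"
    using q U0 by (simp add: powr_def)
  have ln: "ln (q - q\<^sup>2) = L + ln (1 - q)"
  proof -
    have "q - q\<^sup>2 = q * (1 - q)" by (simp add: power2_eq_square algebra_simps)
    thus ?thesis using q by (simp add: ln_mult L_def)
  qed
  have "1 - exp (- (of_real (- L) * (of_nat k + z))) = U"
    by (simp add: U_def mult.commute)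
  hence g: "gpow 1 w (of_real (- L) * (of_nat k + z)) = exp (w * of_real L * (of_nat k + z)) * exp (- w * Ln U)"
    unfolding gpow_1 using U0 by (simp add: powr_def mult.assoc)
  show ?thesis
    unfolding L_def[symmetric] g den qp q_factor_exp[OF q] ln
    by (simp add: algebra_simps flip: exp_add exp_diff)
qed

lemma q_hurwitz_zeta_eq_remove_sings:
  assumes q: "0 < q" "q < 1" and z: "Re z > 0"
  shows "q_hurwitz_zeta w z q = remove_sings (\<lambda>w. q_factor q z w * lattice_sum z (- ln q) w) w"
    and "(\<lambda>w. q_factor q z w * lattice_sum z (- ln q) w) meromorphic_on UNIV"
proof -
  have \<epsilon>: "- ln q > 0" using q by simp
  show m: "(\<lambda>w. q_factor q z w * lattice_sum z (- ln q) w) meromorphic_on UNIV"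
    unfolding q_factor_exp[OF q]
    by (intro meromorphic_on_mult lattice_sum_meromorphic z \<epsilon> analytic_on_imp_meromorphic_on)
       (auto simp: analytic_on_open intro!: holomorphic_intros)
  have "{w. Re w > 0} \<noteq> {}" by (auto intro!: exI[of _ 1])
  moreover have "q_factor q z w * lattice_sum z (- ln q) w =
      (\<Sum>k. complex_of_real q powr (w * (of_nat k + 1)) / qnum q (of_nat k + z) powr w)"
    if "Re w > 0" for w
  proof -
    have "(\<lambda>k. q_factor q z w * gpow 1 w (of_real (- ln q) * (of_nat k + z))) sums
       (q_factor q z w * lattice_sum z (- ln q) w)"
      by (intro sums_mult gpow_sums_lattice_sum z \<epsilon> that)
    thus ?thesis using z by (subst q_hurwitz_term[OF q]) (auto simp: sums_iff)
  qed
  ultimately show "q_hurwitz_zeta w z q = remove_sings (\<lambda>w. q_factor q z w * lattice_sum z (- ln q) w) w"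
    unfolding q_hurwitz_zeta_def
    by (subst mero_cont_eq_remove_sings[OF m]) (auto simp: open_halfspace_Re_gt)
qed

section \<open>Removal of the singularities and the limit as q tends to 1\<close>

lemma eventually_not_Ints: "\<forall>\<^sub>F w in at s. w \<notin> (\<int> :: complex set)"
proof -
  have "\<not> s islimpt \<int>"
    by (rule discrete_imp_not_islimpt[of 1]) (auto simp: dist_norm elim!: Ints_cases simp flip: of_int_diff)
  thus ?thesis by (simp add: islimpt_iff_eventually)
qed

text \<open>For 0 < q < 1 and Re z > 0 the two summands have cancelling poles at w = 0, -1, -2, ...,
  so the meaningful value there is a limit and not the pointwise one.\<close>

definition balanced :: "complex \<Rightarrow> real \<Rightarrow> complex \<Rightarrow> complex" where
  "balanced z q w = q_hurwitz_zeta w z q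
      + (complex_of_real (q - q\<^sup>2) powr w * complex_of_real q powr (- z * w)
          / complex_of_real (ln q)) * (complex_of_real pi / sin (complex_of_real pi * w))"

definition q_ratio :: "real \<Rightarrow> complex \<Rightarrow> complex \<Rightarrow> complex" where
  "q_ratio q z w = exp (w * of_real (ln (q - q\<^sup>2) - ln (- ln q)) - z * w * of_real (ln q))"

text \<open>Near s, but off s, the \<open>remove_sings\<close> inside \<open>q_hurwitz_zeta\<close>
  changes nothing. There \<open>q_factor\<close> is \<open>q_ratio\<close> times the power w of -ln
  q, and the rest is algebra.\<close>

lemma eventually_balanced_eq:
  assumes q: "0 < q" "q < 1" and z: "Re z > 0"
  shows "\<forall>\<^sub>F w in at s. balanced z q w = q_ratio q z w * regularized z (- ln q) w"
proof -
  have "isolated_singularity_at (\<lambda>w. q_factor q z w * lattice_sum z (- ln q) w) s"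
    by (rule meromorphic_on_isolated_singularity, rule meromorphic_on_subset[OF q_hurwitz_zeta_eq_remove_sings(2)[OF assms]]) auto
  from eventually_remove_sings_eq_at[OF this] show ?thesis
  proof eventually_elim
    case (elim w)
    have \<epsilon>: "- ln q > 0" using q by simp
    have "q_factor q z w = q_ratio q z w * of_real (- ln q) powr w"
      using \<epsilon> q by (simp add: q_factor_exp[OF q] q_ratio_def powr_def Ln_of_real algebra_simps flip: exp_add del: of_real_minus)
    moreover have "balanced z q w = q_factor q z w * (lattice_sum z (- ln q) w - of_real pi / (of_real (- ln q) * sin (of_real pi * w)))"
      unfolding balanced_def q_factor_def[symmetric] q_hurwitz_zeta_eq_remove_sings(1)[OF assms] elim
      by (simp add: algebra_simps)
    ultimately show ?case by (simp add: regularized_def mult.assoc)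
  qed
qed

lemma isCont_q_ratio: "isCont (q_ratio q z) w"
  unfolding q_ratio_def by (intro continuous_intros)

text \<open>At noninteger w near s the function is \<open>q_ratio\<close> times
  \<open>jensen\<close>. This product is continuous at s, so its value is the limit there, also when
  s is a nonpositive integer.\<close>

lemma remove_sings_balanced_left:
  assumes z: "Re z > 0" and s: "Re s < 2" "s \<noteq> 1"
  shows "\<forall>\<^sub>F q in at_left 1. remove_sings (balanced z q) s = q_ratio q z s * jensen z (- ln q) s"
proof -
  obtain e where e: "e > 0" "continuous_on {0..e} (\<lambda>\<epsilon>. jensen z \<epsilon> s)"
    "\<And>\<epsilon>. 0 \<le> \<epsilon> \<Longrightarrow> \<epsilon> \<le> e \<Longrightarrow> isCont (jensen z \<epsilon>) s"
    using jensen_continuity[OF assms] by blast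
  have lim: "filterlim (\<lambda>q::real. - ln q) (at_right 0) (at_left 1)" by real_asymp
  have "\<forall>\<^sub>F \<epsilon> in at_right 0. \<epsilon> \<in> {0<..<min e (1 / (norm s + 1))}"
    by (rule eventually_at_right_real) (use e in \<open>auto intro: add_nonneg_pos\<close>)
  from eventually_compose_filterlim[OF this lim]
  have "\<forall>\<^sub>F q in at_left 1. - ln q \<in> {0<..<min e (1 / (norm s + 1))}" .
  moreover have "\<forall>\<^sub>F q::real in at_left 1. q \<in> {0<..<1}"
    by (rule eventually_at_left_real) auto
  ultimately show ?thesis
  proof eventually_elim
    case (elim q)
    define \<epsilon> where "\<epsilon> = - ln q"
    have q: "0 < q" "q < 1" using elim by auto
    have \<epsilon>: "\<epsilon> > 0" "\<epsilon> \<le> e" using elim by (auto simp: \<epsilon>_def)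
    have "0 < norm s + 1" by (simp add: add_nonneg_pos)
    \<comment> \<open>This yields \<open>\<epsilon>\<close> |w| <= 1 for all w within distance 1 of
      s.\<close>
    hence \<epsilon>s: "\<epsilon> * (norm s + 1) < 1" using elim by (simp add: \<epsilon>_def pos_less_divide_eq)
    have "\<forall>\<^sub>F w in nhds s. w \<in> ball s 1 \<inter> {w. Re w < 2}"
      by (rule eventually_nhds_in_open) (use s in \<open>auto simp: open_halfspace_Re_lt\<close>)
    hence "\<forall>\<^sub>F w in at s. w \<in> ball s 1 \<inter> {w. Re w < 2}"
      by (auto simp: eventually_at_filter elim: eventually_mono)
    with eventually_balanced_eq[OF q z, of s] eventually_not_Ints[of s]
    have "\<forall>\<^sub>F w in at s. q_ratio q z w * jensen z \<epsilon> w = balanced z q w"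
    proof eventually_elim
      case (elim w)
      have "norm w \<le> norm s + norm (w - s)" by (metis add.commute diff_add_cancel norm_triangle_ineq)
      also have "\<dots> \<le> norm s + 1" using elim by (auto simp: dist_norm norm_minus_commute)
      finally have "\<epsilon> * norm w \<le> \<epsilon> * (norm s + 1)" using \<epsilon> by (intro mult_left_mono) auto
      hence "\<epsilon> * norm w \<le> 1" using \<epsilon>s by linarith
      hence "regularized z \<epsilon> w = jensen z \<epsilon> w"
        unfolding regularized_def using elim \<epsilon> by (intro lattice_sum_eq_jensen z) auto
      thus ?case using elim by (simp add: \<epsilon>_def)
    qed
    moreover have "(\<lambda>w. q_ratio q z w * jensen z \<epsilon> w) \<midarrow>s\<rightarrow> q_ratio q z s * jensen z \<epsilon> s"
      using isCont_q_ratio[where q = q and z = z and w = s] e(3)[of \<epsilon>] \<epsilon> by (intro tendsto_intros) (auto simp: isCont_def)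
    ultimately have "balanced z q \<midarrow>s\<rightarrow> q_ratio q z s * jensen z \<epsilon> s"
      by (rule Lim_transform_eventually[rotated])
    thus ?case unfolding \<epsilon>_def by (rule remove_sings_eqI)
  qed
qed

text \<open>For Re s > 0 \<open>lattice_sum\<close> is analytic at s, and the sine vanishes only at
  integers, so the right-hand side is continuous at s.\<close>

lemma remove_sings_balanced_right:
  assumes z: "Re z > 0" and s: "Re s > 0" "s \<notin> \<int>" and q: "0 < q" "q < 1"
  shows "remove_sings (balanced z q) s = q_ratio q z s * regularized z (- ln q) s"
proof (rule remove_sings_eqI)
  have \<epsilon>: "- ln q > 0" using q by simp
  have L: "isCont (lattice_sum z (- ln q)) s"
    by (rule analytic_at_imp_isCont, rule lattice_sum_analytic_at) (use z s \<epsilon> in auto)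
  have sin: "sin (of_real pi * s) \<noteq> 0"
  proof
    assume "sin (of_real pi * s) = 0"
    then obtain n :: int where "of_real pi * s = of_real (of_int n * pi)"
      by (auto simp: sin_eq_0)
    hence "s = of_int n" by simp
    thus False using s by auto
  qed
  have "isCont (\<lambda>w. q_ratio q z w * regularized z (- ln q) w) s"
    unfolding regularized_def using \<epsilon> sin
    by (intro continuous_intros isCont_q_ratio L) (auto simp: powr_def intro!: continuous_intros)
  hence "(\<lambda>w. q_ratio q z w * regularized z (- ln q) w) \<midarrow>s\<rightarrow> q_ratio q z s * regularized z (- ln q) s"
    by (simp add: isCont_def)
  moreover have "\<forall>\<^sub>F w in at s. q_ratio q z w * regularized z (- ln q) w = balanced z q w"
    using eventually_balanced_eq[OF q z, of s] by eventually_elim simp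
  ultimately show "balanced z q \<midarrow>s\<rightarrow> q_ratio q z s * regularized z (- ln q) s"
    by (rule Lim_transform_eventually)
qed

text \<open>Both q - q^2 and -ln q behave like 1 - q as q tends to 1.\<close>

lemma tendsto_q_ratio: "((\<lambda>q. q_ratio q z s) \<longlongrightarrow> 1) (at_left 1)"
proof -
  have "((\<lambda>q::real. ln (q - q\<^sup>2) - ln (- ln q)) \<longlongrightarrow> 0) (at_left 1)" by real_asymp
  moreover have "((\<lambda>q::real. ln q) \<longlongrightarrow> 0) (at_left 1)" by real_asymp
  ultimately have "((\<lambda>q. q_ratio q z s) \<longlongrightarrow> exp (s * of_real 0 - z * s * of_real 0)) (at_left 1)"
    unfolding q_ratio_def by (intro tendsto_intros)
  thus ?thesis by simp
qed

theorem theorem2: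
  fixes s z :: complex
  assumes "Re z > 0"
    and "\<And>n::nat. n > 0 \<Longrightarrow> s \<noteq> of_nat n"
  shows "((\<lambda>q::real. remove_sings
             (\<lambda>w. q_hurwitz_zeta w z q
                  + (complex_of_real (q - q\<^sup>2) powr w * complex_of_real q powr (- z * w)
                      / complex_of_real (ln q)) * (complex_of_real pi / sin (complex_of_real pi * w))) s)
          \<longlongrightarrow> hurwitz_zeta s z) (at_left 1)"
proof -
  have lim: "filterlim (\<lambda>q::real. - ln q) (at_right 0) (at_left 1)" by real_asymp
  have s1: "s \<noteq> 1" using assms(2)[of 1] by simp
  have "((\<lambda>q. remove_sings (balanced z q) s) \<longlongrightarrow> jensen z 0 s) (at_left 1)"
  \<comment> \<open>\<open>jensen\<close> is available for Re s < 2. In the remaining half-plane s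
    is not an integer, and the termwise limit applies.\<close>
  proof (cases "Re s < 2")
    case True
    have "((\<lambda>q. q_ratio q z s * jensen z (- ln q) s) \<longlongrightarrow> 1 * jensen z 0 s) (at_left 1)"
      by (intro tendsto_mult tendsto_q_ratio filterlim_compose[OF tendsto_jensen[OF assms(1) True s1] lim])
    moreover have "\<forall>\<^sub>F q in at_left 1. q_ratio q z s * jensen z (- ln q) s = remove_sings (balanced z q) s"
      using remove_sings_balanced_left[OF assms(1) True s1] by eventually_elim simp
    ultimately show ?thesis using Lim_transform_eventually by force
  next
    case False
    have "s \<notin> \<int>"
    proof
      assume "s \<in> \<int>"
      then obtain n where n: "s = of_int n" by (auto elim: Ints_cases)
      hence "s = of_nat (nat n)" "nat n > 0" using False by auto
      thus False using assms(2) by blast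
    qed
    have "\<forall>\<^sub>F q::real in at_left 1. q \<in> {0<..<1}"
      by (rule eventually_at_left_real) auto
    hence "\<forall>\<^sub>F q in at_left 1. q_ratio q z s * regularized z (- ln q) s = remove_sings (balanced z q) s"
      by eventually_elim (use False \<open>s \<notin> \<int>\<close> assms(1) in \<open>auto simp: remove_sings_balanced_right\<close>)
    moreover have "((\<lambda>q. q_ratio q z s * regularized z (- ln q) s) \<longlongrightarrow> 1 * (\<Sum>k. (of_nat k + z) powr (-s))) (at_left 1)"
      by (intro tendsto_mult tendsto_q_ratio filterlim_compose[OF tendsto_regularized_series lim]) (use False assms(1) in auto)
    ultimately show ?thesis
      using Lim_transform_eventually jensen_0_eq_hurwitz_series[OF assms(1), of s] False by force
  qed
  thus ?thesis
    unfolding balanced_def hurwitz_zeta_eq_jensen[OF assms(1) s1] .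
qed

end
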